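(* Let $0<c\le1$ and let $c_d\to c$ as $d\to\infty$. For $l>0$ let $a^c_{d}$-type average acceptance rate $a_d^{c_d}(l)$ be as defined in the context, and let $a^c(l)=\exp(-cf^\ast l/2)$ and $\phi_c(l)=\frac{c\,l^2}{3}\exp(-cf^\ast l/2)$, where $f^\ast=\lim_{x\downarrow0}\frac{f(x)+f(1-x)}{2}$. Then for every $l>0$ $$a_d^{c_d}(l)\to a^c(l)\qquad\text{as } d\to\infty.$$ For fixed $0<c\le1$, $\phi_c(l)$ (as a function of $l>0$) is maximized by $$l=\hat l_c=\frac{4}{cf^\ast},$$ and $$\phi_c(\hat l_c)=\frac1c\,\phi_1(\hat l_1).$$ Also $a^c(\hat l_c)=\exp(-2)$ $(=0.1353$ to four decimal places$)$.
   Context: Let $g:[0,1]\to\mathbb{R}$ be twice differentiable on $[0,1]$ with $\sup_{0\le y\le1}|g'(y)|<\infty$. Let $f$ be the probability density on $\mathbb{R}$ with $f(x)\propto\exp(g(x))1_{\{0<x<1\}}$, and $\pi_d(\mathbf{x}^d)=\prod_{i=1}^d f(x_i)$. Let $c_d\in(0,1]$ with $c_dd$ an integer. In the Metropolis-within-Gibbs algorithm, at each iteration $c_dd$ of the $d$ components are chosen uniformly at random (independently of everything else); from the current state $\mathbf{x}^d$ the proposal $\mathbf{Y}^d$ has $Y_i^d=x_i+\frac{l}{d}Z_i$ for the chosen components $i$, with $Z_i$ i.i.d. uniform on $[-1,1]$, and $Y_i^d=x_i$ otherwise; it is accepted with probability $1\wedge\frac{\pi_d(\mathbf{Y}^d)}{\pi_d(\mathbf{x}^d)}$.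 The average acceptance rate is $$a_d^{c_d}(l)=\mathbb{E}\left[1\wedge\frac{\pi_d(\mathbf{Y}^d)}{\pi_d(\mathbf{X}^d_0)}\right],$$ where $\mathbf{X}_0^d\sim\pi_d$ and $\mathbf{Y}^d$ is the proposal made from $\mathbf{X}_0^d$. *)

theory Defs
  imports "HOL-Probability.Probability"
begin

text \<open>The one-dimensional target density, proportional to \<open>exp (g x)\<close> on the open unit interval.\<close>

definition target_density :: "(real \<Rightarrow> real) \<Rightarrow> real \<Rightarrow> real" where
  "target_density g x =
     indicator {0<..<1} x * exp (g x) / (\<integral>y. indicator {0<..<1} y * exp (g y) \<partial>lborel)"

text \<open>Vectors in \<open>d\<close>-dimensional space are functions on the index set \<open>{..<d}\<close>.\<close>

definition product_density :: "(real \<Rightarrow> real) \<Rightarrow> nat \<Rightarrow> (nat \<Rightarrow> real) \<Rightarrow> real" where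
  "product_density g d x = (\<Prod>i<d. target_density g (x i))"

definition target_measure :: "(real \<Rightarrow> real) \<Rightarrow> nat \<Rightarrow> (nat \<Rightarrow> real) measure" where
  "target_measure g d =
     density (\<Pi>\<^sub>M i\<in>{..<d}. lborel) (\<lambda>x. ennreal (product_density g d x))"

text \<open>Uniform distribution on the sets of exactly \<open>c * d\<close> components out of \<open>d\<close>. This is
  meaningful only when \<open>c * d\<close> is an integer between \<open>0\<close> and \<open>d\<close>.\<close>

definition component_choice :: "real \<Rightarrow> nat \<Rightarrow> nat set measure" where
  "component_choice c d =
     uniform_count_measure {S. S \<subseteq> {..<d} \<and> real (card S) = c * real d}"

text \<open>Increments are drawn for all \<open>d\<close> components; the proposal uses only the chosen ones.\<close>

definition increments :: "nat \<Rightarrow> (nat \<Rightarrow> real) measure" where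
  "increments d = (\<Pi>\<^sub>M i\<in>{..<d}. uniform_measure lborel {-1..1})"

definition proposal ::
  "nat \<Rightarrow> real \<Rightarrow> (nat \<Rightarrow> real) \<Rightarrow> nat set \<Rightarrow> (nat \<Rightarrow> real) \<Rightarrow> nat \<Rightarrow> real" where
  "proposal d l x S z = (\<lambda>i\<in>{..<d}. if i \<in> S then x i + l / real d * z i else x i)"

definition acceptance_prob ::
  "(real \<Rightarrow> real) \<Rightarrow> nat \<Rightarrow> (nat \<Rightarrow> real) \<Rightarrow> (nat \<Rightarrow> real) \<Rightarrow> real" where
  "acceptance_prob g d x y = min 1 (product_density g d y / product_density g d x)"

text \<open>The product measure makes the stationary starting state, the choice of components and the
  increments independent.\<close>

definition avg_acceptance_rate :: "(real \<Rightarrow> real) \<Rightarrow> nat \<Rightarrow> real \<Rightarrow> real \<Rightarrow> real" where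
  "avg_acceptance_rate g d c l =
     (\<integral>(x, S, z). acceptance_prob g d x (proposal d l x S z)
        \<partial>(target_measure g d \<Otimes>\<^sub>M component_choice c d \<Otimes>\<^sub>M increments d))"

definition f_star :: "(real \<Rightarrow> real) \<Rightarrow> real" where
  "f_star g = Lim (at_right 0) (\<lambda>x. (target_density g x + target_density g (1 - x)) / 2)"

definition limit_acceptance_rate :: "(real \<Rightarrow> real) \<Rightarrow> real \<Rightarrow> real \<Rightarrow> real" where
  "limit_acceptance_rate g c l = exp (- c * f_star g * l / 2)"

definition diffusion_speed :: "(real \<Rightarrow> real) \<Rightarrow> real \<Rightarrow> real \<Rightarrow> real" where
  "diffusion_speed g c l = c * l\<^sup>2 / 3 * exp (- c * f_star g * l / 2)"

definition optimal_scaling :: "(real \<Rightarrow> real) \<Rightarrow> real \<Rightarrow> real" where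
  "optimal_scaling g c = 4 / (c * f_star g)"

end

theory Submission
  imports Defs
begin

text \<open>
  Given the set of chosen components, the proposal is accepted with probability \<open>min 1 (exp W)\<close> if
  every proposed coordinate stays in the unit interval, and rejected otherwise, where \<open>W\<close> is the sum
  of the increments of \<open>g\<close>. The proposed coordinates are independent, and each leaves the interval with
  probability asymptotic to \<open>l * f_star g / (2 * d)\<close>, so all \<open>c * d\<close> of them stay inside with
  probability tending to \<open>exp (- c * f_star g * l / 2)\<close>. Replacing \<open>min 1 (exp W)\<close> by \<open>1\<close> costs at
  most the mean of \<open>\<bar>W\<bar>\<close>, which vanishes: the terms of \<open>W\<close> are of order \<open>1 / d\<close> and independent, and
  their common mean is \<open>o(1 / d)\<close> because the increments are centred. All bounds depend on the chosen
  set only through its size, so they survive averaging over it.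
\<close>

section \<open>Product measures\<close>

text \<open>Measures on a finite product are determined by their values on boxes, and on a box both
  the density and the indicator split into one factor per coordinate, so the integral becomes a
  product of one-dimensional integrals. This is what turns the joint target density into independent
  coordinates.\<close>

lemma PiM_density:
  assumes "finite I" and "product_sigma_finite M"
    and "product_sigma_finite (\<lambda>i. density (M i) (f i))"
    and f [measurable]: "\<And>i. f i \<in> borel_measurable (M i)"
  shows "density (Pi\<^sub>M I M) (\<lambda>x. \<Prod>i\<in>I. f i (x i)) = Pi\<^sub>M I (\<lambda>i. density (M i) (f i))"
proof -
  interpret M: product_sigma_finite M by fact
  interpret D: product_sigma_finite "\<lambda>i. density (M i) (f i)" by fact
  have sets_eq: "sets (Pi\<^sub>M I (\<lambda>i. density (M i) (f i))) = sets (Pi\<^sub>M I M)"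
    by (intro sets_PiM_cong) auto
  show ?thesis
  proof (rule D.PiM_eqI[OF assms(1)])
    fix A assume "\<And>i. i \<in> I \<Longrightarrow> A i \<in> sets (density (M i) (f i))"
    then have A: "\<And>i. i \<in> I \<Longrightarrow> A i \<in> sets (M i)" by simp
    have "emeasure (density (Pi\<^sub>M I M) (\<lambda>x. \<Prod>i\<in>I. f i (x i))) (Pi\<^sub>E I A)
        = (\<integral>\<^sup>+x. (\<Prod>i\<in>I. f i (x i)) * indicator (Pi\<^sub>E I A) x \<partial>Pi\<^sub>M I M)"
      using A assms(1) by (subst emeasure_density) (auto intro!: sets_PiM_I_finite)
    also have "\<dots> = (\<integral>\<^sup>+x. (\<Prod>i\<in>I. f i (x i) * indicator (A i) (x i)) \<partial>Pi\<^sub>M I M)"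
    proof (intro nn_integral_cong)
      fix x assume x: "x \<in> space (Pi\<^sub>M I M)"
      have "(indicator (Pi\<^sub>E I A) x :: ennreal) = (\<Prod>i\<in>I. indicator (A i) (x i))"
      proof (cases "\<forall>i\<in>I. x i \<in> A i")
        case True
        then show ?thesis using x by (auto simp: indicator_def PiE_iff space_PiM)
      next
        case False
        then show ?thesis using assms(1) by (auto simp: indicator_def PiE_iff prod_zero_iff)
      qed
      then show "(\<Prod>i\<in>I. f i (x i)) * indicator (Pi\<^sub>E I A) x
          = (\<Prod>i\<in>I. f i (x i) * indicator (A i) (x i))"
        by (simp add: prod.distrib)
    qed
    also have "\<dots> = (\<Prod>i\<in>I. \<integral>\<^sup>+x. f i x * indicator (A i) x \<partial>M i)"
      using A by (intro M.product_nn_integral_prod assms(1)) auto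
    also have "\<dots> = (\<Prod>i\<in>I. emeasure (density (M i) (f i)) (A i))"
      using A by (intro prod.cong) (auto simp: emeasure_density)
    finally show "emeasure (density (Pi\<^sub>M I M) (\<lambda>x. \<Prod>i\<in>I. f i (x i))) (Pi\<^sub>E I A)
        = (\<Prod>i\<in>I. emeasure (density (M i) (f i)) (A i))" .
  qed (simp add: sets_eq)
qed

text \<open>States and increments live in two separate product measures, yet the pairs
  (\<open>x i\<close>, \<open>z i\<close>) are independent of each other. Fubini makes this usable:
  the inner integral factors over the coordinates of \<open>z\<close>, and the resulting functions
  of \<open>x i\<close> factor again in the outer integral.\<close>

lemma integral_pair_PiM_prod:
  fixes F :: "'i \<Rightarrow> 'a \<times> 'b \<Rightarrow> real"
  assumes "finite I" and "prob_space N" and "prob_space U"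
    and F [measurable]: "\<And>i. i \<in> I \<Longrightarrow> F i \<in> borel_measurable (N \<Otimes>\<^sub>M U)"
    and bound: "\<And>i p. i \<in> I \<Longrightarrow> \<bar>F i p\<bar> \<le> B"
  shows "(\<integral>w. (\<Prod>i\<in>I. F i (fst w i, snd w i)) \<partial>(Pi\<^sub>M I (\<lambda>_. N) \<Otimes>\<^sub>M Pi\<^sub>M I (\<lambda>_. U)))
       = (\<Prod>i\<in>I. \<integral>p. F i p \<partial>(N \<Otimes>\<^sub>M U))"
proof -
  interpret N: prob_space N by fact
  interpret U: prob_space U by fact
  interpret NU: pair_prob_space N U ..
  interpret PN: product_prob_space "\<lambda>_. N" I by standard
  interpret PU: product_prob_space "\<lambda>_. U" I by standard
  interpret PP: pair_prob_space "Pi\<^sub>M I (\<lambda>_. N)" "Pi\<^sub>M I (\<lambda>_. U)" ..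
  have meas [measurable]:
    "(\<lambda>w. \<Prod>i\<in>I. F i (fst w i, snd w i)) \<in> borel_measurable (Pi\<^sub>M I (\<lambda>_. N) \<Otimes>\<^sub>M Pi\<^sub>M I (\<lambda>_. U))"
    by (intro borel_measurable_prod) (auto intro!: measurable_compose[OF _ F] measurable_Pair
        measurable_compose[OF measurable_fst] measurable_compose[OF measurable_snd])
  have "\<bar>\<Prod>i\<in>I. F i (fst w i, snd w i)\<bar> \<le> (\<Prod>i\<in>I. B)" for w
    unfolding abs_prod by (intro prod_mono) (auto intro: bound)
  then have int: "integrable (Pi\<^sub>M I (\<lambda>_. N) \<Otimes>\<^sub>M Pi\<^sub>M I (\<lambda>_. U)) (\<lambda>w. \<Prod>i\<in>I. F i (fst w i, snd w i))"
    by (intro PP.integrable_const_bound[where B = "\<Prod>i\<in>I. B"]) auto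
  have intF: "integrable (N \<Otimes>\<^sub>M U) (F i)" if "i \<in> I" for i
    using that bound by (intro NU.integrable_const_bound[where B = B]) auto
  have section_meas: "(\<lambda>z. F i (x, z)) \<in> borel_measurable U" if "i \<in> I" "x \<in> space N" for i x
    using that by (intro measurable_compose[OF _ F]) auto
  have int_section: "integrable U (\<lambda>z. F i (x, z))" if "i \<in> I" "x \<in> space N" for i x
    using that bound by (intro U.integrable_const_bound[where B = B] section_meas) auto
  have "(\<integral>w. (\<Prod>i\<in>I. F i (fst w i, snd w i)) \<partial>(Pi\<^sub>M I (\<lambda>_. N) \<Otimes>\<^sub>M Pi\<^sub>M I (\<lambda>_. U)))
      = (\<integral>x. \<integral>z. (\<Prod>i\<in>I. F i (x i, z i)) \<partial>Pi\<^sub>M I (\<lambda>_. U) \<partial>Pi\<^sub>M I (\<lambda>_. N))"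
    using PP.integral_fst'[OF int] by simp
  also have "\<dots> = (\<integral>x. (\<Prod>i\<in>I. \<integral>z. F i (x i, z) \<partial>U) \<partial>Pi\<^sub>M I (\<lambda>_. N))"
  proof (intro Bochner_Integration.integral_cong refl)
    fix x assume x: "x \<in> space (Pi\<^sub>M I (\<lambda>_. N))"
    show "(\<integral>z. (\<Prod>i\<in>I. F i (x i, z i)) \<partial>Pi\<^sub>M I (\<lambda>_. U)) = (\<Prod>i\<in>I. \<integral>z. F i (x i, z) \<partial>U)"
      using x by (intro PU.product_integral_prod assms int_section) (auto simp: space_PiM PiE_iff)
  qed
  also have "\<dots> = (\<Prod>i\<in>I. \<integral>x. \<integral>z. F i (x, z) \<partial>U \<partial>N)"
    by (intro PN.product_integral_prod assms NU.integrable_fst' intF)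
  also have "\<dots> = (\<Prod>i\<in>I. \<integral>p. F i p \<partial>(N \<Otimes>\<^sub>M U))"
    by (intro prod.cong refl NU.integral_fst' intF)
  finally show ?thesis .
qed

text \<open>Coordinates outside \<open>S\<close> enter the full product with the constant factor 1,
  whose mean is 1, so only \<open>card S\<close> equal factors remain.\<close>

lemma integral_pair_PiM_power:
  fixes F :: "'a \<times> 'b \<Rightarrow> real"
  assumes "finite I" and "S \<subseteq> I" and "prob_space N" and "prob_space U"
    and [measurable]: "F \<in> borel_measurable (N \<Otimes>\<^sub>M U)" and bound: "\<And>p. \<bar>F p\<bar> \<le> B"
  shows "(\<integral>w. (\<Prod>i\<in>S. F (fst w i, snd w i)) \<partial>(Pi\<^sub>M I (\<lambda>_. N) \<Otimes>\<^sub>M Pi\<^sub>M I (\<lambda>_. U)))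
       = (\<integral>p. F p \<partial>(N \<Otimes>\<^sub>M U)) ^ card S"
proof -
  interpret N: prob_space N by fact
  interpret U: prob_space U by fact
  interpret NU: pair_prob_space N U ..
  have restrict: "(\<Prod>i\<in>I. if i \<in> S then h i else 1) = (\<Prod>i\<in>S. h i)" for h :: "'c \<Rightarrow> real"
    using assms(1,2) by (simp flip: prod.inter_restrict add: Int_absorb1)
  have "(\<integral>w. (\<Prod>i\<in>I. (if i \<in> S then F else (\<lambda>_. 1)) (fst w i, snd w i))
        \<partial>(Pi\<^sub>M I (\<lambda>_. N) \<Otimes>\<^sub>M Pi\<^sub>M I (\<lambda>_. U)))
      = (\<Prod>i\<in>I. \<integral>p. (if i \<in> S then F else (\<lambda>_. 1)) p \<partial>(N \<Otimes>\<^sub>M U))"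
    \<comment> \<open>The bound must also cover the constant function 1.\<close>
    by (rule integral_pair_PiM_prod[where B = "max B 1"])
      (use assms(1,3,4) bound in \<open>auto simp: le_max_iff_disj\<close>)
  also have "\<dots> = (\<Prod>i\<in>I. if i \<in> S then \<integral>p. F p \<partial>(N \<Otimes>\<^sub>M U) else 1)"
    by (intro prod.cong refl) (auto simp: NU.prob_space)
  finally show ?thesis
    by (simp add: if_distrib[of "\<lambda>f. f _"] restrict cong: if_cong)
qed

section \<open>Limits and elementary inequalities\<close>

text \<open>The difference quotient is followed along \<open>x + s / real d\<close>, with
  \<open>s\<close> of either sign. Working within \<open>S\<close> admits one-sided derivatives at
  the ends of an interval. For \<open>s = 0\<close> the sequence never leaves \<open>x\<close> and
  the quotient gives no information, but the claim is then trivial.\<close>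

lemma has_real_derivative_imp_sequential:
  fixes f :: "real \<Rightarrow> real"
  assumes "(f has_real_derivative f') (at x within S)"
    and "\<forall>\<^sub>F d in sequentially. x + s / real d \<in> S"
  shows "(\<lambda>d. real d * (f (x + s / real d) - f x)) \<longlonglongrightarrow> s * f'"
proof (cases "s = 0")
  case False
  have "((\<lambda>y. (f y - f x) / (y - x)) \<longlongrightarrow> f') (at x within S)"
    using assms(1) by (simp add: has_field_derivative_iff)
  moreover have "filterlim (\<lambda>d. x + s / real d) (at x within S) sequentially"
    unfolding filterlim_at
  proof
    show "\<forall>\<^sub>F d in sequentially. x + s / real d \<in> S \<and> x + s / real d \<noteq> x"
      using assms(2) eventually_gt_at_top[of 0] by eventually_elim (use False in auto)
    show "(\<lambda>d. x + s / real d) \<longlonglongrightarrow> x"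
      using tendsto_add[OF tendsto_const[of x] lim_const_over_n[of s]] by simp
  qed
  ultimately have "(\<lambda>d. (f (x + s / real d) - f x) / (x + s / real d - x)) \<longlonglongrightarrow> f'"
    by (rule filterlim_compose)
  then have "(\<lambda>d. s * ((f (x + s / real d) - f x) / (x + s / real d - x))) \<longlonglongrightarrow> s * f'"
    by (intro tendsto_intros)
  then show ?thesis
    by (rule Lim_transform_eventually)
      (use eventually_gt_at_top[of 0] in eventually_elim, use False in simp)
qed simp

text \<open>Taking logarithms, \<open>ln (1 - q)\<close> lies between
  \<open>- q - 2 * q\<^sup>2\<close> and \<open>- q\<close> for small \<open>q\<close>; multiplied
  by \<open>k\<close>, both ends tend to \<open>- a\<close> because \<open>k * q * q\<close>
  vanishes.\<close>

lemma one_minus_power_tendsto_exp: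
  fixes q :: "nat \<Rightarrow> real" and k :: "nat \<Rightarrow> nat"
  assumes q: "\<And>d. 0 \<le> q d" and q0: "q \<longlonglongrightarrow> 0" and kq: "(\<lambda>d. real (k d) * q d) \<longlonglongrightarrow> a"
  shows "(\<lambda>d. (1 - q d) ^ k d) \<longlonglongrightarrow> exp (- a)"
proof (rule tendsto_sandwich)
  have small: "\<forall>\<^sub>F d in sequentially. q d < 1/2"
    using q0 by (rule order_tendstoD) simp
  have eq: "(1 - q d) ^ k d = exp (real (k d) * ln (1 - q d))" if "q d < 1/2" for d
    using that by (simp add: exp_of_nat_mult)
  show "\<forall>\<^sub>F d in sequentially. exp (- (real (k d) * q d) - 2 * (real (k d) * q d) * q d) \<le> (1 - q d) ^ k d"
    using small
  proof eventually_elim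
    case (elim d)
    have "real (k d) * (- q d - 2 * (q d)\<^sup>2) \<le> real (k d) * ln (1 - q d)"
      using q[of d] elim by (intro mult_left_mono ln_one_minus_pos_lower_bound) auto
    then show ?case by (simp add: eq[OF elim] algebra_simps power2_eq_square)
  qed
  show "\<forall>\<^sub>F d in sequentially. (1 - q d) ^ k d \<le> exp (- (real (k d) * q d))"
    using small
  proof eventually_elim
    case (elim d)
    have "real (k d) * ln (1 - q d) \<le> real (k d) * (- q d)"
      using q[of d] elim by (intro mult_left_mono ln_one_minus_pos_upper_bound) auto
    then show ?case by (simp add: eq[OF elim])
  qed
  have "(\<lambda>d. exp (- (real (k d) * q d) - 2 * (real (k d) * q d) * q d)) \<longlonglongrightarrow> exp (- a - 2 * a * 0)"
    by (intro tendsto_intros kq q0)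
  then show "(\<lambda>d. exp (- (real (k d) * q d) - 2 * (real (k d) * q d) * q d)) \<longlonglongrightarrow> exp (- a)" by simp
  show "(\<lambda>d. exp (- (real (k d) * q d))) \<longlonglongrightarrow> exp (- a)"
    by (intro tendsto_intros kq)
qed

text \<open>This is \<open>exp u \<ge> 1 + u\<close> at \<open>u = t - 1\<close>. Squared, it says
  that \<open>t\<^sup>2 * exp (- 2 * t)\<close> is largest at \<open>t = 1\<close> among nonnegative
  \<open>t\<close>, which is the optimisation of the diffusion speed after rescaling.\<close>

lemma mult_exp_one_minus_le_one:
  fixes t :: real shows "t * exp (1 - t) \<le> 1"
proof -
  have "t * exp (1 - t) \<le> exp (t - 1) * exp (1 - t)"
    using exp_ge_add_one_self[of "t - 1"] by (intro mult_right_mono) auto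
  then show ?thesis by (simp flip: exp_add)
qed

lemma exp_minus_2_approx: "\<bar>exp (- 2) - (0.1353 :: real)\<bar> < 0.00005"
proof -
  have e: "\<bar>exp 1 - 5837465777 / 2147483648\<bar> \<le> (inverse (2 ^ 32) :: real)" by (rule e_approx_32)
  then have l: "2.71828 \<le> exp (1::real)" and u: "exp (1::real) \<le> 2.71829" by (auto simp: abs_if split: if_splits)
  have eq: "exp (2::real) = exp 1 * exp 1" by (simp flip: exp_add)
  have "2.71828 * 2.71828 \<le> exp (2::real)" "exp (2::real) \<le> 2.71829 * 2.71829"
    unfolding eq using l u by (intro mult_mono; simp)+
  then show ?thesis
    by (simp add: exp_minus abs_less_iff field_simps)
qed

lemma AE_Ioo_Icc: "AE x in lborel. x \<in> {a<..<b} \<longleftrightarrow> x \<in> {a..(b::real)}"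
  using AE_lborel_singleton[of a] AE_lborel_singleton[of b] by eventually_elim auto

section \<open>One coordinate\<close>

text \<open>Derivatives are taken within the closed interval, hence are one-sided at its ends.
  Nothing is assumed about \<open>g\<close> outside it, so measurability and continuity are always
  tied to the interval.\<close>

locale lipschitz_log_density =
  fixes g g' :: "real \<Rightarrow> real" and M :: real
  assumes deriv: "\<And>x. x \<in> {0..1} \<Longrightarrow> (g has_real_derivative g' x) (at x within {0..1})"
    and cont_deriv: "continuous_on {0..1} g'"
    and deriv_bound: "\<And>x. x \<in> {0..1} \<Longrightarrow> \<bar>g' x\<bar> \<le> M"
begin

lemma M_nonneg: "0 \<le> M"
  using deriv_bound[of 0] by simp

lemma lipschitz: "x \<in> {0..1} \<Longrightarrow> y \<in> {0..1} \<Longrightarrow> \<bar>g y - g x\<bar> \<le> M * \<bar>y - x\<bar>"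
  using field_differentiable_bound[of "{0..1}" g g' M y x] deriv deriv_bound by auto

lemma cont_g: "continuous_on {0..1} g"
  using deriv by (rule DERIV_continuous_on)

lemma measurable_g [measurable]: "(\<lambda>x. indicator {0<..<1} x * g x) \<in> borel_measurable borel"
proof -
  have "(\<lambda>x. indicator {0<..<1} x *\<^sub>R g x) \<in> borel_measurable borel"
    by (intro borel_measurable_continuous_on_indicator continuous_on_subset[OF cont_g]) auto
  then show ?thesis by simp
qed

lemma measurable_deriv [measurable]: "(\<lambda>x. indicator {0<..<1} x * g' x) \<in> borel_measurable borel"
proof -
  have "(\<lambda>x. indicator {0<..<1} x *\<^sub>R g' x) \<in> borel_measurable borel"
    by (intro borel_measurable_continuous_on_indicator continuous_on_subset[OF cont_deriv]) auto
  then show ?thesis by simp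
qed

section \<open>Normalising constant and density\<close>

definition normalizer :: real where
  "normalizer = (\<integral>y. indicator {0<..<1} y * exp (g y) \<partial>lborel)"

text \<open>The target density without its indicator: it is continuous up to the boundary, so
  \<open>density0 0\<close> and \<open>density0 1\<close> are the boundary limits from which
  \<open>f_star\<close> is built.\<close>

definition density0 :: "real \<Rightarrow> real" where
  "density0 x = exp (g x) / normalizer"

text \<open>The Lipschitz bound gives \<open>g x \<ge> g 0 - M\<close>. A positive lower bound keeps
  the normalising constant away from zero.\<close>

lemma exp_g_lower: obtains m where "0 < m" "\<And>x. x \<in> {0..1} \<Longrightarrow> m \<le> exp (g x)"
proof
  show "\<And>x. x \<in> {0..1} \<Longrightarrow> exp (g 0 - M) \<le> exp (g x)"
  proof -
    fix x :: real assume x: "x \<in> {0..1}"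
    have "\<bar>g x - g 0\<bar> \<le> M * \<bar>x - 0\<bar>" using x by (intro lipschitz) auto
    also have "\<dots> \<le> M * 1" using x M_nonneg by (intro mult_left_mono) auto
    finally show "exp (g 0 - M) \<le> exp (g x)" by simp
  qed
qed simp

lemma cont_exp_g: "continuous_on {0..1} (\<lambda>x. exp (g x))"
  by (intro continuous_intros cont_g)

lemma integrable_exp_g: "integrable lborel (\<lambda>x. indicator {0<..<1} x * exp (g x))"
proof -
  have "set_integrable lborel {0..1} (\<lambda>x. exp (g x))"
    by (intro borel_integrable_atLeastAtMost' cont_exp_g)
  then have "set_integrable lborel {0<..<1} (\<lambda>x. exp (g x))"
    by (rule set_integrable_subset) auto
  then show ?thesis by (simp add: set_integrable_def)
qed

lemma normalizer_pos: "0 < normalizer"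
proof -
  obtain m where m: "0 < m" "\<And>x. x \<in> {0..1} \<Longrightarrow> m \<le> exp (g x)"
    using exp_g_lower by blast
  have "m = (\<integral>y. indicator {0<..<1} y * m \<partial>(lborel :: real measure))" by simp
  also have "\<dots> \<le> normalizer"
    unfolding normalizer_def
  proof (intro integral_mono integrable_exp_g)
    show "integrable lborel (\<lambda>y. indicator {0<..<1::real} y * m)"
      by (intro integrable_mult_left integrable_real_indicator) auto
  qed (auto simp: indicator_def m)
  finally show ?thesis using m(1) by simp
qed

lemma target_density_eq: "target_density g x = indicator {0<..<1} x * density0 x"
  by (simp add: target_density_def density0_def normalizer_def)

lemma density0_pos: "0 < density0 x"
  using normalizer_pos by (simp add: density0_def)

lemma cont_density0: "continuous_on {0..1} density0"
  unfolding density0_def using normalizer_pos by (intro continuous_intros cont_g) auto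

lemma density0_bounded: obtains B where "\<And>x. x \<in> {0..1} \<Longrightarrow> density0 x \<le> B"
proof -
  have "bdd_above (density0 ` {0..1})"
    by (intro bounded_imp_bdd_above compact_imp_bounded compact_continuous_image cont_density0) auto
  then show ?thesis using that unfolding bdd_above_def by blast
qed

lemma target_density_nonneg: "0 \<le> target_density g x"
  using density0_pos[of x] by (auto simp: target_density_eq indicator_def)

lemma measurable_target_density [measurable]: "target_density g \<in> borel_measurable borel"
proof -
  have "(\<lambda>x. indicator {0<..<1} x *\<^sub>R density0 x) \<in> borel_measurable borel"
    by (intro borel_measurable_continuous_on_indicator continuous_on_subset[OF cont_density0]) auto
  then show ?thesis by (simp add: target_density_eq[abs_def])
qed

lemma integrable_target_density: "integrable lborel (target_density g)"
  using integrable_divide[OF integrable_exp_g, of normalizer]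
  by (simp add: target_density_eq[abs_def] density0_def)

lemma integral_target_density: "(\<integral>x. target_density g x \<partial>lborel) = 1"
  using normalizer_pos
  by (simp add: target_density_def normalizer_def[symmetric])

section \<open>One-dimensional laws of state and increment\<close>

definition target1 :: "real measure" where
  "target1 = density lborel (\<lambda>x. ennreal (target_density g x))"

definition increment1 :: "real measure" where
  "increment1 = uniform_measure lborel {-1..1}"

lemma sets_target1 [measurable_cong, simp]: "sets target1 = sets borel"
  by (simp add: target1_def)

lemma sets_increment1 [measurable_cong, simp]: "sets increment1 = sets borel"
  by (simp add: increment1_def)

lemma space_target1 [simp]: "space target1 = UNIV"
  by (simp add: target1_def)

lemma space_increment1 [simp]: "space increment1 = UNIV"
  by (simp add: increment1_def)

lemma prob_space_target1: "prob_space target1"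
proof
  have "emeasure target1 (space target1) = (\<integral>\<^sup>+x. ennreal (target_density g x) \<partial>lborel)"
    by (simp add: target1_def emeasure_density)
  also have "\<dots> = ennreal (\<integral>x. target_density g x \<partial>lborel)"
    by (intro nn_integral_eq_integral integrable_target_density) (auto simp: target_density_nonneg)
  finally show "emeasure target1 (space target1) = 1" by (simp add: integral_target_density)
qed

lemma prob_space_increment1: "prob_space increment1"
  unfolding increment1_def by (intro prob_space_uniform_measure) auto

sublocale T: prob_space target1 by (rule prob_space_target1)
sublocale V: prob_space increment1 by (rule prob_space_increment1)
sublocale TV: pair_prob_space target1 increment1 ..

lemma AE_target1: "AE x in target1. x \<in> {0<..<1}"
  unfolding target1_def
  by (subst AE_density, measurable) (auto simp: target_density_eq indicator_def)

lemma AE_increment1: "AE z in increment1. z \<in> {-1..1}"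
  unfolding increment1_def by (intro AE_uniform_measureI) auto

lemma increment1_eq: "increment1 = density lborel (\<lambda>z. ennreal (indicator {-1..1} z / 2))"
  unfolding increment1_def uniform_measure_def
  by (intro density_cong) (auto simp: indicator_def divide_ennreal simp flip: ennreal_1 ennreal_numeral)

lemma integral_increment1:
  fixes f :: "real \<Rightarrow> real"
  assumes [measurable]: "f \<in> borel_measurable borel"
  shows "(\<integral>z. f z \<partial>increment1) = (\<integral>z. f z * indicator {-1..1} z \<partial>lborel) / 2"
  unfolding increment1_eq by (subst integral_real_density) (auto simp: mult.commute)

lemma integral_increment1_FTC:
  assumes "f \<in> borel_measurable borel"
    and "a \<le> b" "-1 \<le> a" "b \<le> 1"
    and F: "\<And>x. a \<le> x \<Longrightarrow> x \<le> b \<Longrightarrow> DERIV F x :> f x"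
    and "\<And>x. a \<le> x \<Longrightarrow> x \<le> b \<Longrightarrow> isCont f x"
  shows "(\<integral>z. f z * indicator {a..b} z \<partial>increment1) = (F b - F a) / 2"
proof -
  have "(\<integral>z. f z * indicator {a..b} z \<partial>increment1)
      = (\<integral>z. f z * indicator {a..b} z * indicator {-1..1} z \<partial>lborel) / 2"
    using assms(1) by (intro integral_increment1) auto
  also have "(\<lambda>z. f z * indicator {a..b} z * indicator {-1..1} z) = (\<lambda>z. f z * indicator {a..b} z)"
    using assms(3,4) by (auto simp: indicator_def)
  also have "(\<integral>z. f z * indicator {a..b} z \<partial>lborel) = F b - F a"
    using assms by (intro integral_FTC_Icc_real) auto
  finally show ?thesis .
qed

text \<open>Inside the interval \<open>target_density\<close> agrees with the continuous
  \<open>density0\<close>, so the limit is read off at the two ends.\<close>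

lemma f_star_eq: "f_star g = (density0 0 + density0 1) / 2"
proof -
  have 0: "(density0 \<longlongrightarrow> density0 0) (at_right 0)" and 1: "(density0 \<longlongrightarrow> density0 1) (at_left 1)"
    using cont_density0 by (auto simp: continuous_on_Icc_at_rightD continuous_on_Icc_at_leftD)
  \<comment> \<open>Reflection carries right neighbourhoods of 0 to left neighbourhoods of 1, so the
    second half of \<open>f_star\<close> is a left limit at 1.\<close>
  have "filterlim (\<lambda>x::real. 1 - x) (at_left 1) (at_right 0)"
    unfolding filterlim_at
    using eventually_at_right_less[of "0::real"]
    by (auto intro!: tendsto_eq_intros elim!: eventually_mono)
  then have 1: "((\<lambda>x. density0 (1 - x)) \<longlongrightarrow> density0 1) (at_right 0)"
    using 1 by (rule filterlim_compose[rotated])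
  have "((\<lambda>x. (density0 x + density0 (1 - x)) / 2) \<longlongrightarrow> (density0 0 + density0 1) / 2) (at_right 0)"
    by (intro tendsto_intros 0 1) auto
  then have "((\<lambda>x. (target_density g x + target_density g (1 - x)) / 2) \<longlongrightarrow> (density0 0 + density0 1) / 2)
      (at_right 0)"
  proof (rule Lim_transform_eventually)
    show "\<forall>\<^sub>F x in at_right 0. (density0 x + density0 (1 - x)) / 2
        = (target_density g x + target_density g (1 - x)) / 2"
      using eventually_at_right_real[of 0 1]
      by (auto elim!: eventually_mono simp: target_density_eq)
  qed
  then show ?thesis unfolding f_star_def by (intro tendsto_Lim) auto
qed

lemma f_star_pos: "0 < f_star g"
  using density0_pos[of 0] density0_pos[of 1] by (simp add: f_star_eq)

text \<open>Real-valued, so that a product over the chosen coordinates is the indicator that all of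
  them stay in the interval.\<close>

definition inside :: "real \<Rightarrow> real \<times> real \<Rightarrow> real" where
  "inside h p = indicator {0<..<1} (fst p + h * snd p)"

text \<open>The factors other than the difference make this bounded and measurable everywhere, without
  any assumption on \<open>g\<close> outside the unit interval.\<close>

definition log_ratio :: "real \<Rightarrow> real \<times> real \<Rightarrow> real" where
  "log_ratio h p = indicator {0<..<1} (fst p) * indicator {-1..1} (snd p) * inside h p
     * (g (fst p + h * snd p) - g (fst p))"

lemma measurable_inside [measurable]: "inside h \<in> borel_measurable (target1 \<Otimes>\<^sub>M increment1)"
  unfolding inside_def[abs_def] by measurable

lemma measurable_log_ratio [measurable]:
  "log_ratio h \<in> borel_measurable (target1 \<Otimes>\<^sub>M increment1)"
proof -
  \<comment> \<open>\<open>G\<close> is \<open>g\<close> cut off to zero outside the interval, hence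
    measurable everywhere; wherever the indicators are nonzero both arguments lie inside, so nothing
    changes.\<close>
  define G where "G x = indicator {0<..<1} x * g x" for x
  have [measurable]: "G \<in> borel_measurable borel"
    unfolding G_def[abs_def] by (rule measurable_g)
  have "log_ratio h = (\<lambda>p. indicator {0<..<1} (fst p) * indicator {-1..1} (snd p) * inside h p
     * (G (fst p + h * snd p) - G (fst p)))"
    by (auto simp: log_ratio_def inside_def G_def indicator_def)
  also have "\<dots> \<in> borel_measurable (target1 \<Otimes>\<^sub>M increment1)" by measurable
  finally show ?thesis .
qed

lemma inside_cases: "inside h p = 0 \<or> inside h p = 1"
  by (auto simp: inside_def indicator_def)

lemma log_ratio_bound:
  assumes "0 \<le> h" shows "\<bar>log_ratio h p\<bar> \<le> M * h"
proof (cases "fst p \<in> {0<..<1} \<and> snd p \<in> {-1..1} \<and> fst p + h * snd p \<in> {0<..<1}")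
  case True
  then have "\<bar>log_ratio h p\<bar> \<le> M * \<bar>fst p + h * snd p - fst p\<bar>"
    using lipschitz[of "fst p" "fst p + h * snd p"] by (auto simp: log_ratio_def inside_def)
  also have "\<dots> = M * (h * \<bar>snd p\<bar>)" using assms by (simp add: abs_mult)
  also have "\<dots> \<le> M * (h * 1)"
    using True assms M_nonneg by (intro mult_left_mono) auto
  finally show ?thesis by simp
next
  case False
  then show ?thesis using assms M_nonneg by (auto simp: log_ratio_def inside_def)
qed

lemma eventually_inside:
  assumes "x \<in> {0<..<1::real}"
  shows "\<forall>\<^sub>F d in sequentially. x + s / real d \<in> {0<..<1}"
proof -
  have "(\<lambda>d. x + s / real d) \<longlonglongrightarrow> x"
    using tendsto_add[OF tendsto_const[of x] lim_const_over_n[of s]] by simp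
  then show ?thesis using assms by (intro topological_tendstoD) auto
qed

text \<open>The limit of the rescaled mean is the mean of \<open>l * z * g' x\<close>, which vanishes because the
  increment \<open>z\<close> is centred and independent of \<open>x\<close>.\<close>

lemma mean_log_ratio:
  assumes "0 < l"
  shows "(\<lambda>d. real d * (\<integral>p. log_ratio (l / real d) p \<partial>(target1 \<Otimes>\<^sub>M increment1))) \<longlonglongrightarrow> 0"
proof -
  define L where
    "L = (\<lambda>p. l * (indicator {-1..1} (snd p) * snd p) * (indicator {0<..<1} (fst p) * g' (fst p)))"
  have meas_L [measurable]: "L \<in> borel_measurable (target1 \<Otimes>\<^sub>M increment1)"
    unfolding L_def by measurable
  have "(\<lambda>d. \<integral>p. real d * log_ratio (l / real d) p \<partial>(target1 \<Otimes>\<^sub>M increment1))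
      \<longlonglongrightarrow> (\<integral>p. L p \<partial>(target1 \<Otimes>\<^sub>M increment1))"
  \<comment> \<open>The Lipschitz bound \<open>M * (l / d)\<close> times \<open>d\<close> gives the
    dominating constant, uniformly in \<open>d\<close>.\<close>
  proof (rule integral_dominated_convergence[where w = "\<lambda>_. M * l"])
    show "AE p in target1 \<Otimes>\<^sub>M increment1. (\<lambda>d. real d * log_ratio (l / real d) p) \<longlonglongrightarrow> L p"
    proof (intro AE_I2)
      fix p :: "real \<times> real"
      show "(\<lambda>d. real d * log_ratio (l / real d) p) \<longlonglongrightarrow> L p"
      proof (cases "fst p \<in> {0<..<1} \<and> snd p \<in> {-1..1}")
        case True
        have "\<forall>\<^sub>F d in sequentially. fst p + (l * snd p) / real d \<in> {0<..<1}"
          using True by (intro eventually_inside) auto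
        moreover have "(\<lambda>d. real d * (g (fst p + (l * snd p) / real d) - g (fst p)))
            \<longlonglongrightarrow> (l * snd p) * g' (fst p)"
          using True calculation
          by (intro has_real_derivative_imp_sequential[where S = "{0..1}"] deriv)
            (auto elim!: eventually_mono)
        ultimately have "(\<lambda>d. real d * log_ratio (l / real d) p) \<longlonglongrightarrow> (l * snd p) * g' (fst p)"
          using True
          by (rule_tac Lim_transform_eventually)
            (auto elim!: eventually_mono simp: log_ratio_def inside_def)
        then show ?thesis using True by (simp add: L_def)
      qed (auto simp: log_ratio_def L_def)
    qed
    show "AE p in target1 \<Otimes>\<^sub>M increment1. norm (real d * log_ratio (l / real d) p) \<le> M * l" for d
    proof (intro AE_I2)
      fix p
      have "\<bar>real d * log_ratio (l / real d) p\<bar> \<le> real d * (M * (l / real d))"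
        unfolding abs_mult using log_ratio_bound[of "l / real d" p] assms
        by (intro mult_mono) auto
      \<comment> \<open>An inequality rather than an equality: at \<open>d = 0\<close> the left side
        is 0.\<close>
      also have "\<dots> \<le> M * l" using M_nonneg assms by simp
      finally show "norm (real d * log_ratio (l / real d) p) \<le> M * l" by simp
    qed
  qed auto
  moreover have "(\<integral>p. L p \<partial>(target1 \<Otimes>\<^sub>M increment1)) = 0"
  proof -
    have "\<bar>L p\<bar> \<le> l * 1 * M" for p
      unfolding L_def abs_mult using assms deriv_bound[of "fst p"] M_nonneg
      by (intro mult_mono) (auto simp: indicator_def)
    then have "integrable (target1 \<Otimes>\<^sub>M increment1) L"
      by (intro TV.integrable_const_bound[where B = "l * 1 * M"]) auto
    then have "(\<integral>p. L p \<partial>(target1 \<Otimes>\<^sub>M increment1)) = (\<integral>x. \<integral>z. L (x, z) \<partial>increment1 \<partial>target1)"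
      by (simp add: TV.integral_fst')
    moreover have "(\<integral>z. L (x, z) \<partial>increment1) = 0" for x
    proof -
      have "(\<integral>z. z * indicator {-1..1} z \<partial>increment1) = 0"
        by (subst integral_increment1_FTC[where F = "\<lambda>z. z\<^sup>2 / 2"]) (auto intro!: derivative_eq_intros)
      then show ?thesis by (simp add: L_def mult.commute[of "indicator _ _"])
    qed
    ultimately show ?thesis by simp
  qed
  ultimately show ?thesis by simp
qed

section \<open>Probability of leaving the unit interval\<close>

text \<open>\<open>F\<close> is an antiderivative of the continuous \<open>density0\<close> and
  serves as the distribution function of one coordinate. It is fixed only up to a constant, but only
  its differences appear.\<close>

lemma cdf_exists:
  obtains F where
    "\<And>x. x \<in> {0..1} \<Longrightarrow> (F has_real_derivative density0 x) (at x within {0..1})"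
    "\<And>a b. 0 \<le> a \<Longrightarrow> a \<le> b \<Longrightarrow> b \<le> 1 \<Longrightarrow> (\<integral>x. indicator {a<..<b} x \<partial>target1) = F b - F a"
proof -
  obtain F where F: "\<And>x. x \<in> {0..1} \<Longrightarrow> (F has_vector_derivative density0 x) (at x within {0..1})"
    using antiderivative_continuous[OF cont_density0] by blast
  have "(\<integral>x. indicator {a<..<b} x \<partial>target1) = F b - F a" if ab: "0 \<le> a" "a \<le> b" "b \<le> 1" for a b
  proof -
    have "(\<integral>x. indicator {a<..<b} x \<partial>target1) = (\<integral>x. target_density g x * indicator {a<..<b} x \<partial>lborel)"
      unfolding target1_def
      by (subst integral_real_density) (auto simp: target_density_nonneg)
    also have "\<dots> = (\<integral>x. indicator {a<..<b} x *\<^sub>R density0 x \<partial>lborel)"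
      using ab by (intro Bochner_Integration.integral_cong) (auto simp: target_density_eq indicator_def)
    \<comment> \<open>The endpoints form a null set; passing to the closed interval prepares the
      fundamental theorem of calculus.\<close>
    also have "\<dots> = (\<integral>x. indicator {a..b} x *\<^sub>R density0 x \<partial>lborel)"
    proof (rule integral_cong_AE)
      show "AE x in lborel. indicator {a<..<b} x *\<^sub>R density0 x = indicator {a..b} x *\<^sub>R density0 x"
        using AE_Ioo_Icc[of a b] by eventually_elim (auto simp: indicator_def)
    qed (use ab in \<open>auto simp del: real_scaleR_def intro!: borel_measurable_continuous_on_indicator
            continuous_on_subset[OF cont_density0]\<close>)
    also have "\<dots> = F b - F a"
      using ab by (intro integral_FTC_Icc continuous_on_subset[OF cont_density0]
          has_vector_derivative_within_subset[OF F]) auto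
    finally show ?thesis .
  qed
  then show thesis
    using F that by (auto simp: has_real_derivative_iff_has_vector_derivative)
qed

definition stay :: "real \<Rightarrow> real" where
  "stay t = (\<integral>x. indicator {0<..<1} (x + t) \<partial>target1)"

lemma stay_le_1: "stay t \<le> 1" and stay_nonneg: "0 \<le> stay t"
proof -
  have "integrable target1 (\<lambda>x. indicator {0<..<1} (x + t) :: real)"
    by (intro T.integrable_const_bound[where B = 1]) auto
  then show "stay t \<le> 1" unfolding stay_def by (intro T.integral_le_const) auto
qed (auto simp: stay_def)

text \<open>An upward shift by \<open>t\<close> loses the mass above \<open>1 - t\<close>, a
  downward shift the mass below \<open>t\<close>. The total mass \<open>F 1 - F 0\<close> is 1,
  which turns the staying probabilities into these increments of \<open>F\<close>.\<close>

lemma stay_exit: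
  obtains F where
    "\<And>x. x \<in> {0..1} \<Longrightarrow> (F has_real_derivative density0 x) (at x within {0..1})"
    "\<And>t. 0 \<le> t \<Longrightarrow> t \<le> 1 \<Longrightarrow> 1 - stay t = F 1 - F (1 - t)"
    "\<And>t. 0 \<le> t \<Longrightarrow> t \<le> 1 \<Longrightarrow> 1 - stay (- t) = F t - F 0"
proof -
  obtain F where F: "\<And>x. x \<in> {0..1} \<Longrightarrow> (F has_real_derivative density0 x) (at x within {0..1})"
    and Fint: "\<And>a b. 0 \<le> a \<Longrightarrow> a \<le> b \<Longrightarrow> b \<le> 1 \<Longrightarrow> (\<integral>x. indicator {a<..<b} x \<partial>target1) = F b - F a"
    using cdf_exists by blast
  have "(\<integral>x. indicator {0<..<1} x \<partial>target1) = (\<integral>x. (1 :: real) \<partial>target1)"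
    by (intro integral_cong_AE eventually_mono[OF AE_target1]) auto
  then have total: "F 1 - F 0 = 1" using Fint[of 0 1] T.prob_space by simp
  have "stay t = F (1 - t) - F 0" if "0 \<le> t" "t \<le> 1" for t
  proof -
    have "stay t = (\<integral>x. indicator {0<..<1 - t} x \<partial>target1)"
      unfolding stay_def
      using that
      by (intro integral_cong_AE eventually_mono[OF AE_target1]) (auto simp: indicator_def)
    then show ?thesis using that Fint[of 0 "1 - t"] by simp
  qed
  moreover have "stay (- t) = F 1 - F t" if "0 \<le> t" "t \<le> 1" for t
  proof -
    have "stay (- t) = (\<integral>x. indicator {t<..<1} x \<partial>target1)"
      unfolding stay_def
      using that
      by (intro integral_cong_AE eventually_mono[OF AE_target1]) (auto simp: indicator_def)
    then show ?thesis using that Fint[of t 1] by simp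
  qed
  ultimately show thesis using that[OF F] total by simp
qed

text \<open>For shifts of size at most 1 the exit mass is an increment of \<open>F\<close>, which is
  Lipschitz because its derivative is bounded. The linear bound later supplies the dominating
  function.\<close>

lemma exit_bound: obtains B where "0 \<le> B" "\<And>t. 1 - stay t \<le> B * \<bar>t\<bar>"
proof -
  obtain B where B: "\<And>x. x \<in> {0..1} \<Longrightarrow> density0 x \<le> B" using density0_bounded by blast
  have B0: "0 \<le> B" using B[of 0] density0_pos[of 0] by simp
  obtain F where F: "\<And>x. x \<in> {0..1} \<Longrightarrow> (F has_real_derivative density0 x) (at x within {0..1})"
    and pos: "\<And>t. 0 \<le> t \<Longrightarrow> t \<le> 1 \<Longrightarrow> 1 - stay t = F 1 - F (1 - t)"
    and neg: "\<And>t. 0 \<le> t \<Longrightarrow> t \<le> 1 \<Longrightarrow> 1 - stay (- t) = F t - F 0"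
    using stay_exit by blast
  have lip: "\<bar>F x - F y\<bar> \<le> B * \<bar>x - y\<bar>" if "x \<in> {0..1}" "y \<in> {0..1}" for x y
    using field_differentiable_bound[of "{0..1}" F density0 B x y] F B that density0_pos
    by (simp add: less_imp_le)
  \<comment> \<open>The extra 1 covers shifts larger than 1, where the exit probability is at most 1
    anyway.\<close>
  have "1 - stay t \<le> (B + 1) * \<bar>t\<bar>" for t
  proof -
    consider "1 < \<bar>t\<bar>" | "0 \<le> t" "t \<le> 1" | "-1 \<le> t" "t < 0" by linarith
    then show ?thesis
    proof cases
      case 1
      then show ?thesis using stay_nonneg[of t] mult_nonneg_nonneg[OF B0 abs_ge_zero[of t]]
        unfolding distrib_right by linarith
    next
      case 2
      then show ?thesis using pos[of t] lip[of 1 "1 - t"] by (simp add: distrib_right)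
    next
      case 3
      then show ?thesis using neg[of "- t"] lip[of "- t" 0] by (simp add: distrib_right)
    qed
  qed
  then show thesis using that[of "B + 1"] B0 by simp
qed

text \<open>Fubini with the state integrated first: given the increment, the probability of
  remaining inside is a value of \<open>stay\<close>.\<close>

lemma integral_inside:
  "(\<integral>p. inside h p \<partial>(target1 \<Otimes>\<^sub>M increment1)) = (\<integral>z. stay (h * z) \<partial>increment1)"
  and measurable_stay: "(\<lambda>z. stay (h * z)) \<in> borel_measurable borel"
proof -
  have int: "integrable (target1 \<Otimes>\<^sub>M increment1) (case_prod (\<lambda>x z. inside h (x, z)))"
    by (intro TV.integrable_const_bound[where B = 1]) (auto simp: inside_def indicator_def)
  then show "(\<integral>p. inside h p \<partial>(target1 \<Otimes>\<^sub>M increment1)) = (\<integral>z. stay (h * z) \<partial>increment1)"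
    using TV.integral_snd[OF int] by (simp add: inside_def stay_def split_beta')
  show "(\<lambda>z. stay (h * z)) \<in> borel_measurable borel"
    unfolding stay_def by measurable
qed

text \<open>A positive increment \<open>z\<close> can exit only at 1, with probability near
  \<open>l * z * density0 1 / d\<close>, and a negative one only at 0, with probability near
  \<open>l * \<bar>z\<bar> * density0 0 / d\<close>. Averaging over \<open>z\<close> gives each end
  weight 1/4, and \<open>f_star\<close> is the mean of the two boundary values.\<close>

lemma exit_probability:
  assumes "0 < l"
  shows "(\<lambda>d. real d * (1 - (\<integral>p. inside (l / real d) p \<partial>(target1 \<Otimes>\<^sub>M increment1))))
    \<longlonglongrightarrow> l * f_star g / 2"
proof -
  define R where "R = (\<lambda>z. l * density0 0 * (- z * indicator {-1..0} z)
    + l * density0 1 * (z * indicator {0..1} z))"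
  note [measurable] = measurable_stay
  obtain B where B: "0 \<le> B" "\<And>t. 1 - stay t \<le> B * \<bar>t\<bar>" using exit_bound by blast
  obtain F where F: "\<And>x. x \<in> {0..1} \<Longrightarrow> (F has_real_derivative density0 x) (at x within {0..1})"
    and pos: "\<And>t. 0 \<le> t \<Longrightarrow> t \<le> 1 \<Longrightarrow> 1 - stay t = F 1 - F (1 - t)"
    and neg: "\<And>t. 0 \<le> t \<Longrightarrow> t \<le> 1 \<Longrightarrow> 1 - stay (- t) = F t - F 0"
    using stay_exit by blast
  \<comment> \<open>The formulas for \<open>stay\<close> hold for shifts of size at most 1, so
    \<open>d\<close> has to be large enough.\<close>
  have small: "\<forall>\<^sub>F d in sequentially. s / real d \<in> {0..1}" if "0 \<le> s" for s
    using eventually_ge_at_top[of "nat \<lceil>s\<rceil> + 1"]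
    by eventually_elim (use that in \<open>auto simp: divide_le_eq\<close>, linarith)
  have pointwise: "(\<lambda>d. real d * (1 - stay (l / real d * z))) \<longlonglongrightarrow> R z" if z: "z \<in> {-1..1}" for z
  proof (cases "0 \<le> z")
    case True
    have sm: "\<forall>\<^sub>F d in sequentially. (l * z) / real d \<in> {0..1}"
      using True assms by (intro small) auto
    \<comment> \<open>The one-sided derivative of \<open>F\<close> at 1, approached from
      below.\<close>
    have "(\<lambda>d. real d * (F (1 + (- (l * z)) / real d) - F 1)) \<longlonglongrightarrow> (- (l * z)) * density0 1"
      using sm by (intro has_real_derivative_imp_sequential[OF F]) (auto elim!: eventually_mono)
    from tendsto_minus[OF this]
    have "(\<lambda>d. real d * (1 - stay (l / real d * z))) \<longlonglongrightarrow> - ((- (l * z)) * density0 1)"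
      by (rule Lim_transform_eventually) (use sm in eventually_elim, simp add: pos algebra_simps)
    then show ?thesis using True z by (auto simp: R_def indicator_def mult_ac)
  next
    case False
    have sm: "\<forall>\<^sub>F d in sequentially. (- (l * z)) / real d \<in> {0..1}"
      using False assms by (intro small) (auto simp: mult_nonneg_nonpos)
    have "(\<lambda>d. real d * (F (0 + (- (l * z)) / real d) - F 0)) \<longlonglongrightarrow> (- (l * z)) * density0 0"
      using sm by (intro has_real_derivative_imp_sequential[OF F]) (auto elim!: eventually_mono)
    then have "(\<lambda>d. real d * (1 - stay (l / real d * z))) \<longlonglongrightarrow> (- (l * z)) * density0 0"
      by (rule Lim_transform_eventually)
        (use sm in eventually_elim, use neg[of "(- (l * z)) / real _"] in simp)
    then show ?thesis using False z by (auto simp: R_def indicator_def mult_ac)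
  qed
  have "(\<lambda>d. \<integral>z. real d * (1 - stay (l / real d * z)) \<partial>increment1) \<longlonglongrightarrow> (\<integral>z. R z \<partial>increment1)"
  proof (rule integral_dominated_convergence[where w = "\<lambda>_. B * l"])
    show "AE z in increment1. (\<lambda>d. real d * (1 - stay (l / real d * z))) \<longlonglongrightarrow> R z"
      using AE_increment1 by eventually_elim (rule pointwise)
    show "AE z in increment1. norm (real d * (1 - stay (l / real d * z))) \<le> B * l" for d
      using AE_increment1
    proof eventually_elim
      case (elim z)
      have "norm (real d * (1 - stay (l / real d * z))) = real d * (1 - stay (l / real d * z))"
        using stay_le_1 by simp
      also have "\<dots> \<le> real d * (B * \<bar>l / real d * z\<bar>)"
        by (intro mult_left_mono B) auto
      also have "\<dots> \<le> B * l * \<bar>z\<bar>"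
        using assms B(1) by (simp add: abs_mult)
      also have "\<dots> \<le> B * l * 1"
        using elim assms B(1) by (intro mult_left_mono) auto
      finally show ?case by simp
    qed
  qed (simp_all add: R_def del: times_divide_eq_left)
  moreover have "(\<integral>z. R z \<partial>increment1) = l * f_star g / 2"
  proof -
    \<comment> \<open>The density contributes one factor 1/2, the integral of
      \<open>\<bar>z\<bar>\<close> over one side the other.\<close>
    have 1: "(\<integral>z. - z * indicator {-1..0} z \<partial>increment1) = 1 / 4"
      by (subst integral_increment1_FTC[where F = "\<lambda>z. - z\<^sup>2 / 2"]) (auto intro!: derivative_eq_intros)
    have 2: "(\<integral>z. z * indicator {0..1} z \<partial>increment1) = 1 / 4"
      by (subst integral_increment1_FTC[where F = "\<lambda>z. z\<^sup>2 / 2"]) (auto intro!: derivative_eq_intros)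
    have "integrable increment1 (\<lambda>z. - z * indicator {-1..0} z)"
      "integrable increment1 (\<lambda>z. z * indicator {0..1} z)"
      by (intro V.integrable_const_bound[where B = 1]; auto simp: indicator_def)+
    then have "(\<integral>z. R z \<partial>increment1) = l * density0 0 * (1 / 4) + l * density0 1 * (1 / 4)"
      unfolding R_def by (simp only: Bochner_Integration.integral_add integrable_mult_right
          integral_mult_right_zero 1 2)
    then show ?thesis by (simp add: f_star_eq field_simps)
  qed
  moreover have "(\<integral>z. real d * (1 - stay (l / real d * z)) \<partial>increment1)
      = real d * (1 - (\<integral>p. inside (l / real d) p \<partial>(target1 \<Otimes>\<^sub>M increment1)))" for d
  proof -
    have "integrable increment1 (\<lambda>z. stay (l / real d * z))"
      by (intro V.integrable_const_bound[where B = 1])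
        (simp_all add: stay_nonneg stay_le_1 del: times_divide_eq_left)
    then show ?thesis using V.prob_space by (simp add: integral_inside)
  qed
  ultimately show ?thesis by (simp only:)
qed

section \<open>The product chain\<close>

abbreviation targets :: "nat \<Rightarrow> (nat \<Rightarrow> real) measure" where
  "targets d \<equiv> Pi\<^sub>M {..<d} (\<lambda>_. target1)"

lemma target_measure_eq: "target_measure g d = targets d"
proof -
  have "product_sigma_finite (\<lambda>_::nat. target1)" by unfold_locales
  then have "density (Pi\<^sub>M {..<d} (\<lambda>_. lborel)) (\<lambda>x. \<Prod>i<d. ennreal (target_density g (x i))) = targets d"
    unfolding target1_def
    by (intro PiM_density) (auto intro: product_sigma_finite.intro lborel.sigma_finite_measure_axioms)
  then show ?thesis
    by (simp add: target_measure_def product_density_def prod_ennreal target_density_nonneg)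
qed

lemma increments_eq: "increments d = Pi\<^sub>M {..<d} (\<lambda>_. increment1)"
  by (simp add: increments_def increment1_def)

lemma prob_space_targets: "prob_space (targets d)"
  by (intro prob_space_PiM prob_space_target1)

lemma prob_space_increments: "prob_space (increments d)"
  unfolding increments_eq by (intro prob_space_PiM prob_space_increment1)

section \<open>Acceptance for a fixed set of components\<close>

text \<open>With \<open>S\<close> fixed, the remaining randomness is a pair of independent vectors,
  to which the product formulas for pairs apply.\<close>

definition acceptance :: "nat \<Rightarrow> real \<Rightarrow> nat set \<Rightarrow> (nat \<Rightarrow> real) \<times> (nat \<Rightarrow> real) \<Rightarrow> real" where
  "acceptance d l S w = acceptance_prob g d (fst w) (proposal d l (fst w) S (snd w))"

lemma product_density_nonneg: "0 \<le> product_density g d x"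
  by (simp add: product_density_def prod_nonneg target_density_nonneg)

lemma acceptance_bounds: "0 \<le> acceptance d l S w" "acceptance d l S w \<le> 1"
  by (auto simp: acceptance_def acceptance_prob_def product_density_nonneg)

text \<open>An untouched coordinate contributes the ratio 1, since the density is positive at
  \<open>x i\<close>. In a chosen one the normalising constant cancels, leaving the exponential of
  the log ratio inside the interval and 0 outside. The conditions on \<open>x\<close> and
  \<open>z\<close> hold almost surely.\<close>

lemma acceptance_eq:
  assumes S: "S \<subseteq> {..<d}"
    and x: "\<And>i. i < d \<Longrightarrow> x i \<in> {0<..<1}" and z: "\<And>i. i < d \<Longrightarrow> z i \<in> {-1..1}"
  shows "acceptance d l S (x, z) = min 1 ((\<Prod>i\<in>S. inside (l / real d) (x i, z i))
    * exp (\<Sum>i\<in>S. log_ratio (l / real d) (x i, z i)))"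
proof -
  let ?y = "proposal d l x S z" and ?h = "l / real d"
  have fin: "finite S" using S finite_subset by blast
  have "product_density g d ?y / product_density g d x
      = (\<Prod>i<d. target_density g (?y i) / target_density g (x i))"
    by (simp add: product_density_def prod_dividef)
  also have "\<dots> = (\<Prod>i<d. if i \<in> S then inside ?h (x i, z i) * exp (log_ratio ?h (x i, z i)) else 1)"
  proof (intro prod.cong refl)
    fix i assume "i \<in> {..<d}"
    then have "i < d" "x i \<in> {0<..<1}" "z i \<in> {-1..1}" using x z by auto
    then show "target_density g (?y i) / target_density g (x i)
        = (if i \<in> S then inside ?h (x i, z i) * exp (log_ratio ?h (x i, z i)) else 1)"
      using density0_pos[of "x i"] normalizer_pos
      by (auto simp: proposal_def target_density_eq inside_def log_ratio_def density0_def exp_diff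
          indicator_def)
  qed
  also have "\<dots> = (\<Prod>i\<in>S. inside ?h (x i, z i) * exp (log_ratio ?h (x i, z i)))"
    using S by (simp flip: prod.inter_restrict add: Int_absorb1)
  also have "\<dots> = (\<Prod>i\<in>S. inside ?h (x i, z i)) * exp (\<Sum>i\<in>S. log_ratio ?h (x i, z i))"
    using fin by (simp add: prod.distrib exp_sum)
  finally show ?thesis by (simp add: acceptance_def acceptance_prob_def)
qed

text \<open>The product of the indicators is 0 or 1. If it is 0 the proposal is rejected and both
  terms vanish; if it is 1 the error is \<open>\<bar>min 1 (exp b) - 1\<bar>\<close> with
  \<open>b\<close> the summed log ratios, at most \<open>\<bar>b\<bar>\<close> because
  \<open>exp b \<ge> 1 + b\<close>.\<close>

lemma acceptance_approx:
  assumes S: "S \<subseteq> {..<d}"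
    and x: "\<And>i. i < d \<Longrightarrow> x i \<in> {0<..<1}" and z: "\<And>i. i < d \<Longrightarrow> z i \<in> {-1..1}"
  shows "\<bar>acceptance d l S (x, z) - (\<Prod>i\<in>S. inside (l / real d) (x i, z i))\<bar>
    \<le> \<bar>\<Sum>i\<in>S. log_ratio (l / real d) (x i, z i)\<bar>"
proof -
  have fin: "finite S" using S finite_subset by blast
  have "(\<Prod>i\<in>S. inside (l / real d) (x i, z i)) = 0 \<or> (\<Prod>i\<in>S. inside (l / real d) (x i, z i)) = 1"
  proof (cases "\<exists>i\<in>S. inside (l / real d) (x i, z i) = 0")
    case False
    then have "\<forall>i\<in>S. inside (l / real d) (x i, z i) = 1" using inside_cases by blast
    then show ?thesis by simp
  qed (use fin in auto)
  moreover have "\<bar>min 1 (a * exp b) - a\<bar> \<le> \<bar>b\<bar>" if "a = 0 \<or> a = 1" for a b :: real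
  proof -
    have "\<bar>min 1 (exp b) - 1\<bar> \<le> \<bar>b\<bar>" using exp_ge_add_one_self[of b] by linarith
    then show ?thesis using that by auto
  qed
  ultimately show ?thesis
    by (subst acceptance_eq) (use assms in auto)
qed

text \<open>The hypothesis on \<open>C\<close> covers two uses: the uniform law on the component
  sets, and the full discrete space in which a single \<open>S\<close> can be fixed.\<close>

lemma measurable_acceptance_joint [measurable]:
  assumes "sets C = sets (count_space \<S>)"
  shows "(\<lambda>(x, S, z). acceptance_prob g d x (proposal d l x S z))
    \<in> borel_measurable (targets d \<Otimes>\<^sub>M C \<Otimes>\<^sub>M increments d)"
proof -
  note [measurable_cong] = assms
  have [measurable]: "(\<lambda>w. i \<in> fst (snd w)) \<in> measurable (targets d \<Otimes>\<^sub>M C \<Otimes>\<^sub>M increments d) (count_space UNIV)"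
    for i
    by (rule measurable_compose[of "\<lambda>w. fst (snd w)" _ C "\<lambda>S. i \<in> S"]) measurable
  have state: "(\<lambda>w. fst w i) \<in> borel_measurable (targets d \<Otimes>\<^sub>M C \<Otimes>\<^sub>M increments d)" if "i < d" for i
    using that by (intro measurable_compose[OF measurable_fst]) auto
  have increment: "(\<lambda>w. snd (snd w) i) \<in> borel_measurable (targets d \<Otimes>\<^sub>M C \<Otimes>\<^sub>M increments d)" if "i < d" for i
    using that unfolding increments_eq
    by (intro measurable_compose[OF measurable_snd[THEN measurable_compose, OF measurable_snd]]) auto
  have num: "(\<lambda>w. product_density g d (proposal d l (fst w) (fst (snd w)) (snd (snd w))))
      \<in> borel_measurable (targets d \<Otimes>\<^sub>M C \<Otimes>\<^sub>M increments d)"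
    unfolding product_density_def proposal_def
  proof (intro borel_measurable_prod measurable_compose[OF _ measurable_target_density])
    fix i assume i: "i \<in> {..<d}"
    then have [measurable]: "(\<lambda>w. fst w i) \<in> borel_measurable (targets d \<Otimes>\<^sub>M C \<Otimes>\<^sub>M increments d)"
      "(\<lambda>w. snd (snd w) i) \<in> borel_measurable (targets d \<Otimes>\<^sub>M C \<Otimes>\<^sub>M increments d)"
      using state increment by auto
    have "(\<lambda>w. if i \<in> fst (snd w) then fst w i + l / real d * snd (snd w) i else fst w i)
        \<in> borel_measurable (targets d \<Otimes>\<^sub>M C \<Otimes>\<^sub>M increments d)"
      by measurable
    then show "(\<lambda>w. (\<lambda>i\<in>{..<d}. if i \<in> fst (snd w) then fst w i + l / real d * snd (snd w) i
        else fst w i) i) \<in> borel_measurable (targets d \<Otimes>\<^sub>M C \<Otimes>\<^sub>M increments d)"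
      using i by simp
  qed
  have den: "(\<lambda>w. product_density g d (fst w)) \<in> borel_measurable (targets d \<Otimes>\<^sub>M C \<Otimes>\<^sub>M increments d)"
    unfolding product_density_def
    by (intro borel_measurable_prod measurable_compose[OF _ measurable_target_density]) (auto intro: state)
  show ?thesis
    unfolding split_beta' acceptance_prob_def
    by (intro borel_measurable_min borel_measurable_divide num den) auto
qed

lemma measurable_acceptance [measurable]:
  "acceptance d l S \<in> borel_measurable (targets d \<Otimes>\<^sub>M increments d)"
proof -
  have "(\<lambda>w. (fst w, S, snd w)) \<in> measurable (targets d \<Otimes>\<^sub>M increments d)
      (targets d \<Otimes>\<^sub>M count_space UNIV \<Otimes>\<^sub>M increments d)"
    by measurable
  from measurable_compose[OF this measurable_acceptance_joint[OF refl, of d l]]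
  show ?thesis by (simp add: acceptance_def[abs_def])
qed

lemma AE_state_increments:
  "AE w in targets d \<Otimes>\<^sub>M increments d. (\<forall>i<d. fst w i \<in> {0<..<1} \<and> snd w i \<in> {-1..1})"
proof -
  interpret X: prob_space "targets d" by (rule prob_space_targets)
  interpret Z: prob_space "increments d" by (rule prob_space_increments)
  interpret XZ: pair_prob_space "targets d" "increments d" ..
  have X: "AE x in targets d. \<forall>i\<in>{..<d}. x i \<in> {0<..<1}"
    by (intro AE_finite_allI AE_PiM_component prob_space_target1 AE_target1) auto
  have Z: "AE z in increments d. \<forall>i\<in>{..<d}. z i \<in> {-1..1}"
    unfolding increments_eq
    by (intro AE_finite_allI AE_PiM_component prob_space_increment1 AE_increment1) auto
  show ?thesis
  proof (rule XZ.AE_pair_measure)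
    have [measurable]: "(\<lambda>w. fst w i) \<in> borel_measurable (targets d \<Otimes>\<^sub>M increments d)" if "i < d" for i
      using that by (intro measurable_compose[OF measurable_fst]) auto
    have [measurable]: "(\<lambda>w. snd w i) \<in> borel_measurable (targets d \<Otimes>\<^sub>M increments d)" if "i < d" for i
      using that unfolding increments_eq by (intro measurable_compose[OF measurable_snd]) auto
    have "{w \<in> space (targets d \<Otimes>\<^sub>M increments d). \<forall>i\<in>{..<d}. fst w i \<in> {0<..<1} \<and> snd w i \<in> {-1..1}}
        \<in> sets (targets d \<Otimes>\<^sub>M increments d)"
      by (intro sets.sets_Collect_finite_All) auto
    then show "{w \<in> space (targets d \<Otimes>\<^sub>M increments d). \<forall>i<d. fst w i \<in> {0<..<1} \<and> snd w i \<in> {-1..1}}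
        \<in> sets (targets d \<Otimes>\<^sub>M increments d)"
      by (simp add: Ball_def)
    show "AE x in targets d. AE z in increments d.
        \<forall>i<d. fst (x, z) i \<in> {0<..<1} \<and> snd (x, z) i \<in> {-1..1}"
      using X
    proof eventually_elim
      case (elim x)
      from Z show ?case by eventually_elim (use elim in auto)
    qed
  qed
qed

text \<open>Expanding the square, each diagonal term is at most \<open>(M * h)\<^sup>2\<close> and
  each off-diagonal term factors into the squared mean by independence. With
  \<open>h = l / d\<close> both parts of the bound vanish as \<open>d\<close> grows: the first is of
  order \<open>1 / d\<close>, the second is controlled by the rescaled mean.\<close>

lemma second_moment_sum_log_ratio:
  assumes S: "S \<subseteq> {..<d}" and h: "0 \<le> h"
  shows "(\<integral>w. (\<Sum>i\<in>S. log_ratio h (fst w i, snd w i))\<^sup>2 \<partial>(targets d \<Otimes>\<^sub>M increments d))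
    \<le> card S * (M * h)\<^sup>2 + (card S * (\<integral>p. log_ratio h p \<partial>(target1 \<Otimes>\<^sub>M increment1)))\<^sup>2"
proof -
  interpret X: prob_space "targets d" by (rule prob_space_targets)
  interpret Z: prob_space "increments d" by (rule prob_space_increments)
  interpret XZ: pair_prob_space "targets d" "increments d" ..
  let ?r = "\<lambda>i w. log_ratio h (fst w i, snd w i)"
  let ?m = "\<integral>p. log_ratio h p \<partial>(target1 \<Otimes>\<^sub>M increment1)"
  have fin: "finite S" using S finite_subset by blast
  have [measurable]: "?r i \<in> borel_measurable (targets d \<Otimes>\<^sub>M increments d)" if "i \<in> S" for i
  proof -
    have "i < d" using S that by auto
    then have "(\<lambda>w. (fst w i, snd w i)) \<in> measurable (targets d \<Otimes>\<^sub>M increments d) (target1 \<Otimes>\<^sub>M increment1)"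
      unfolding increments_eq
      by (intro measurable_Pair measurable_compose[OF measurable_fst] measurable_compose[OF measurable_snd]) auto
    then show ?thesis by (rule measurable_compose[OF _ measurable_log_ratio])
  qed
  have bound: "\<bar>?r i w * ?r j w\<bar> \<le> (M * h)\<^sup>2" for i j w
    unfolding abs_mult power2_eq_square using M_nonneg h by (intro mult_mono log_ratio_bound) auto
  have int: "integrable (targets d \<Otimes>\<^sub>M increments d) (\<lambda>w. ?r i w * ?r j w)" if "i \<in> S" "j \<in> S" for i j
  proof (rule XZ.integrable_const_bound)
    show "AE w in targets d \<Otimes>\<^sub>M increments d. norm (?r i w * ?r j w) \<le> (M * h)\<^sup>2"
      unfolding real_norm_def by (intro AE_I2 bound)
  qed (use that in measurable)
  \<comment> \<open>The squared mean is added on the diagonal too, so that the double sum takes a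
    simple closed form.\<close>
  have pair: "(\<integral>w. ?r i w * ?r j w \<partial>(targets d \<Otimes>\<^sub>M increments d)) \<le> (if i = j then (M * h)\<^sup>2 else 0) + ?m\<^sup>2"
    if ij: "i \<in> S" "j \<in> S" for i j
  proof (cases "i = j")
    case True
    have "(\<integral>w. ?r i w * ?r j w \<partial>(targets d \<Otimes>\<^sub>M increments d)) \<le> (M * h)\<^sup>2"
      using ij by (intro XZ.integral_le_const int AE_I2 abs_le_D1[OF bound]) auto
    then show ?thesis using True by (simp add: add_increasing2)
  next
    case False
    have "(\<integral>w. (\<Prod>k\<in>{i, j}. log_ratio h (fst w k, snd w k)) \<partial>(targets d \<Otimes>\<^sub>M increments d)) = ?m ^ card {i, j}"
      unfolding increments_eq using S ij log_ratio_bound[OF h]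
      by (intro integral_pair_PiM_power[where B = "M * h"] prob_space_target1 prob_space_increment1) auto
    then show ?thesis using False by (simp add: power2_eq_square)
  qed
  have "(\<integral>w. (\<Sum>i\<in>S. ?r i w)\<^sup>2 \<partial>(targets d \<Otimes>\<^sub>M increments d))
      = (\<integral>w. (\<Sum>i\<in>S. \<Sum>j\<in>S. ?r i w * ?r j w) \<partial>(targets d \<Otimes>\<^sub>M increments d))"
    by (simp add: power2_eq_square sum_product)
  also have "\<dots> = (\<Sum>i\<in>S. \<Sum>j\<in>S. \<integral>w. ?r i w * ?r j w \<partial>(targets d \<Otimes>\<^sub>M increments d))"
    using int by (subst Bochner_Integration.integral_sum; (intro Bochner_Integration.integrable_sum)?)
      (auto intro!: sum.cong Bochner_Integration.integral_sum)
  also have "\<dots> \<le> (\<Sum>i\<in>S. \<Sum>j\<in>S. (if i = j then (M * h)\<^sup>2 else 0) + ?m\<^sup>2)"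
    by (intro sum_mono pair)
  also have "\<dots> = card S * ((M * h)\<^sup>2 + card S * ?m\<^sup>2)"
    using fin by (simp add: sum.distrib)
  also have "\<dots> = card S * (M * h)\<^sup>2 + (card S * ?m)\<^sup>2"
    by (simp only: distrib_left power_mult_distrib power2_eq_square[of "real (card S)"] mult.assoc)
  finally show ?thesis .
qed

text \<open>By independence the mean of the product of indicators is a power. The error is at most
  the mean of \<open>\<bar>W\<bar>\<close>, with \<open>W\<close> the summed log ratios, and hence
  at most the root of its second moment.\<close>

lemma acceptance_given_components:
  assumes S: "S \<subseteq> {..<d}" and l: "0 < l"
  defines "h \<equiv> l / real d"
  shows "\<bar>(\<integral>w. acceptance d l S w \<partial>(targets d \<Otimes>\<^sub>M increments d))
      - (\<integral>p. inside h p \<partial>(target1 \<Otimes>\<^sub>M increment1)) ^ card S\<bar>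
    \<le> sqrt (card S * (M * h)\<^sup>2 + (card S * (\<integral>p. log_ratio h p \<partial>(target1 \<Otimes>\<^sub>M increment1)))\<^sup>2)"
proof -
  interpret X: prob_space "targets d" by (rule prob_space_targets)
  interpret Z: prob_space "increments d" by (rule prob_space_increments)
  interpret XZ: pair_prob_space "targets d" "increments d" ..
  let ?P = "targets d \<Otimes>\<^sub>M increments d"
  let ?A = "\<lambda>w. \<Prod>i\<in>S. inside h (fst w i, snd w i)"
  let ?W = "\<lambda>w. \<Sum>i\<in>S. log_ratio h (fst w i, snd w i)"
  have h: "0 \<le> h" using l by (simp add: h_def)
  have pair: "(\<lambda>w. (fst w i, snd w i)) \<in> measurable ?P (target1 \<Otimes>\<^sub>M increment1)" if "i \<in> S" for i
  proof -
    have "i < d" using S that by auto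
    then show ?thesis
      unfolding increments_eq
      by (intro measurable_Pair measurable_compose[OF measurable_fst] measurable_compose[OF measurable_snd]) auto
  qed
  have [measurable]: "?A \<in> borel_measurable ?P" "?W \<in> borel_measurable ?P"
    by (auto intro!: borel_measurable_prod borel_measurable_sum measurable_compose[OF pair])
  have A_bound: "\<bar>?A w\<bar> \<le> 1" for w
    unfolding abs_prod by (intro prod_le_1) (auto simp: inside_def indicator_def)
  have W_bound: "\<bar>?W w\<bar> \<le> card S * (M * h)" for w
  proof -
    have "\<bar>?W w\<bar> \<le> (\<Sum>i\<in>S. \<bar>log_ratio h (fst w i, snd w i)\<bar>)" by (rule sum_abs)
    also have "\<dots> \<le> (\<Sum>i\<in>S. M * h)" by (intro sum_mono log_ratio_bound h)
    finally show ?thesis by simp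
  qed
  have int_acc: "integrable ?P (acceptance d l S)"
    using acceptance_bounds by (intro XZ.integrable_const_bound[where B = 1]) auto
  have int_A: "integrable ?P ?A"
    using A_bound by (intro XZ.integrable_const_bound[where B = 1]) auto
  have int_W: "integrable ?P ?W"
    using W_bound by (intro XZ.integrable_const_bound[where B = "card S * (M * h)"]) auto
  have "\<bar>(?W w)\<^sup>2\<bar> \<le> (card S * (M * h))\<^sup>2" for w
    using W_bound[of w] power_mono[of "\<bar>?W w\<bar>" "card S * (M * h)" 2] by simp
  then have int_W2: "integrable ?P (\<lambda>w. (?W w)\<^sup>2)"
    by (intro XZ.integrable_const_bound[where B = "(card S * (M * h))\<^sup>2"]) auto
  have "(\<integral>w. ?A w \<partial>?P) = (\<integral>p. inside h p \<partial>(target1 \<Otimes>\<^sub>M increment1)) ^ card S"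
    unfolding increments_eq using S
    by (intro integral_pair_PiM_power[where B = 1] prob_space_target1 prob_space_increment1)
      (auto simp: inside_def indicator_def)
  then have "\<bar>(\<integral>w. acceptance d l S w \<partial>?P) - (\<integral>p. inside h p \<partial>(target1 \<Otimes>\<^sub>M increment1)) ^ card S\<bar>
      = \<bar>\<integral>w. acceptance d l S w - ?A w \<partial>?P\<bar>"
    using int_acc int_A by simp
  also have "\<dots> \<le> (\<integral>w. \<bar>acceptance d l S w - ?A w\<bar> \<partial>?P)"
    by (rule integral_abs_bound)
  also have "\<dots> \<le> (\<integral>w. \<bar>?W w\<bar> \<partial>?P)"
  proof (rule integral_mono_AE)
    show "AE w in ?P. \<bar>acceptance d l S w - ?A w\<bar> \<le> \<bar>?W w\<bar>"
      using AE_state_increments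
    proof eventually_elim
      case (elim w)
      then show ?case
        using acceptance_approx[OF S, of "fst w" "snd w" l] by (simp add: h_def)
    qed
  qed (use int_acc int_A int_W in auto)
  also have "\<dots> \<le> sqrt (\<integral>w. (?W w)\<^sup>2 \<partial>?P)"
  proof (rule real_le_rsqrt)
    \<comment> \<open>The Cauchy-Schwarz inequality in the form that the variance of
      \<open>\<bar>W\<bar>\<close> is nonnegative.\<close>
    have "XZ.variance (\<lambda>w. \<bar>?W w\<bar>) = (\<integral>w. (?W w)\<^sup>2 \<partial>?P) - (\<integral>w. \<bar>?W w\<bar> \<partial>?P)\<^sup>2"
      using int_W int_W2 by (subst XZ.variance_eq) auto
    then show "(\<integral>w. \<bar>?W w\<bar> \<partial>?P)\<^sup>2 \<le> (\<integral>w. (?W w)\<^sup>2 \<partial>?P)"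
      using XZ.variance_positive[of "\<lambda>w. \<bar>?W w\<bar>"] by simp
  qed
  also have "\<dots> \<le> sqrt (card S * (M * h)\<^sup>2 + (card S * (\<integral>p. log_ratio h p \<partial>(target1 \<Otimes>\<^sub>M increment1)))\<^sup>2)"
    by (intro real_sqrt_le_mono second_moment_sum_log_ratio S h)
  finally show ?thesis .
qed

section \<open>Averaging over the chosen components\<close>

text \<open>Fubini isolates the discrete variable \<open>S\<close>, whose uniform law turns the
  integral into an arithmetic mean. With the natural number \<open>k\<close> in place of
  \<open>c * d\<close>, the choice is among sets of size exactly \<open>k\<close>, and
  \<open>k \<le> d\<close> makes this family nonempty.\<close>

lemma avg_acceptance_rate_eq:
  assumes k: "c * real d = real k" "k \<le> d"
  defines "\<S> \<equiv> {S. S \<subseteq> {..<d} \<and> card S = k}"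
  shows "avg_acceptance_rate g d c l
    = (\<Sum>S\<in>\<S>. \<integral>w. acceptance d l S w \<partial>(targets d \<Otimes>\<^sub>M increments d)) / card \<S>"
proof -
  interpret X: prob_space "targets d" by (rule prob_space_targets)
  interpret Z: prob_space "increments d" by (rule prob_space_increments)
  interpret XZ: pair_prob_space "targets d" "increments d" ..
  have fin: "finite \<S>" unfolding \<S>_def by simp
  have "card {..<k} = k" "{..<k} \<subseteq> {..<d}" using k(2) by auto
  then have ne: "\<S> \<noteq> {}" unfolding \<S>_def by blast
  define C where "C = uniform_count_measure \<S>"
  have C: "component_choice c d = C"
    by (simp add: component_choice_def C_def \<S>_def k(1))
  have sets_C: "sets C = sets (count_space \<S>)"
    by (simp add: C_def sets_uniform_count_measure_count_space)
  have space_C: "space C = \<S>" by (simp add: C_def space_uniform_count_measure)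
  interpret C: prob_space C
    unfolding C_def by (rule prob_space_uniform_count_measure[OF fin ne])
  interpret CZ: pair_prob_space C "increments d" ..
  interpret XCZ: pair_prob_space "targets d" "C \<Otimes>\<^sub>M increments d" ..
  let ?f = "\<lambda>(x, S, z). acceptance_prob g d x (proposal d l x S z)"
  have f: "?f (x, S, z) = acceptance d l S (x, z)" for x S z
    by (simp add: acceptance_def)
  have f_bound: "\<bar>?f w\<bar> \<le> 1" for w
    using acceptance_bounds[of d l "fst (snd w)" "(fst w, snd (snd w))"]
    by (cases w) (simp add: acceptance_def)
  have meas: "?f \<in> borel_measurable (targets d \<Otimes>\<^sub>M C \<Otimes>\<^sub>M increments d)"
    by (rule measurable_acceptance_joint[OF sets_C])
  have int: "integrable (targets d \<Otimes>\<^sub>M C \<Otimes>\<^sub>M increments d) ?f"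
    using f_bound meas by (intro XCZ.integrable_const_bound[where B = 1]) auto
  have int_acc: "integrable (targets d \<Otimes>\<^sub>M increments d) (acceptance d l S)" for S
    using acceptance_bounds by (intro XZ.integrable_const_bound[where B = 1]) auto
  have "avg_acceptance_rate g d c l = (\<integral>x. \<integral>p. ?f (x, p) \<partial>(C \<Otimes>\<^sub>M increments d) \<partial>targets d)"
    unfolding avg_acceptance_rate_def target_measure_eq C
    by (rule XCZ.integral_fst'[OF int, symmetric])
  also have "\<dots> = (\<integral>x. (\<Sum>S\<in>\<S>. \<integral>z. acceptance d l S (x, z) \<partial>increments d) / card \<S> \<partial>targets d)"
  proof (intro Bochner_Integration.integral_cong refl)
    fix x assume x: "x \<in> space (targets d)"
    have "integrable (C \<Otimes>\<^sub>M increments d) (\<lambda>p. ?f (x, p))"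
      using f_bound x
      by (intro CZ.integrable_const_bound[where B = 1] measurable_compose[OF _ meas]) auto
    then have "(\<integral>p. ?f (x, p) \<partial>(C \<Otimes>\<^sub>M increments d)) = (\<integral>S. \<integral>z. ?f (x, S, z) \<partial>increments d \<partial>C)"
      by (rule CZ.integral_fst'[symmetric])
    also have "\<dots> = (\<integral>S. \<integral>z. acceptance d l S (x, z) \<partial>increments d \<partial>C)"
      unfolding f ..
    finally show "(\<integral>p. ?f (x, p) \<partial>(C \<Otimes>\<^sub>M increments d))
        = (\<Sum>S\<in>\<S>. \<integral>z. acceptance d l S (x, z) \<partial>increments d) / card \<S>"
      unfolding C_def by (simp only: integral_uniform_count_measure[OF fin])
  qed
  also have "\<dots> = (\<Sum>S\<in>\<S>. \<integral>x. \<integral>z. acceptance d l S (x, z) \<partial>increments d \<partial>targets d) / card \<S>"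
    using XZ.integrable_fst'[OF int_acc] by simp
  also have "\<dots> = (\<Sum>S\<in>\<S>. \<integral>w. acceptance d l S w \<partial>(targets d \<Otimes>\<^sub>M increments d)) / card \<S>"
    using XZ.integral_fst'[OF int_acc] by simp
  finally show ?thesis .
qed

text \<open>All sets in the average have the same size, hence the same error bound around the same
  value, and a mean of such quantities obeys it too.\<close>

lemma avg_acceptance_rate_approx:
  assumes k: "c * real d = real k" "k \<le> d" and l: "0 < l"
  defines "h \<equiv> l / real d"
  shows "\<bar>avg_acceptance_rate g d c l - (\<integral>p. inside h p \<partial>(target1 \<Otimes>\<^sub>M increment1)) ^ k\<bar>
    \<le> sqrt (k * (M * h)\<^sup>2 + (k * (\<integral>p. log_ratio h p \<partial>(target1 \<Otimes>\<^sub>M increment1)))\<^sup>2)"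
    (is "\<bar>_ - ?a\<bar> \<le> ?e")
proof -
  let ?S = "{S. S \<subseteq> {..<d} \<and> card S = k}"
  let ?J = "\<lambda>S. \<integral>w. acceptance d l S w \<partial>(targets d \<Otimes>\<^sub>M increments d)"
  have "card {..<k} = k" "{..<k} \<subseteq> {..<d}" using k(2) by auto
  then have "?S \<noteq> {}" by blast
  then have pos: "0 < card ?S" by (simp add: card_gt_0_iff)
  have "avg_acceptance_rate g d c l - ?a = (\<Sum>S\<in>?S. ?J S - ?a) / card ?S"
  proof -
    have "s / n - a = (s - n * a) / n" if "0 < n" for s n a :: real
      using that by (simp add: diff_divide_distrib)
    then show ?thesis
      unfolding avg_acceptance_rate_eq[OF k] sum_subtractf sum_constant using pos by simp
  qed
  then have "\<bar>avg_acceptance_rate g d c l - ?a\<bar> = \<bar>\<Sum>S\<in>?S. ?J S - ?a\<bar> / card ?S"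
    by simp
  also have "\<dots> \<le> (\<Sum>S\<in>?S. ?e) / card ?S"
    using acceptance_given_components[OF _ l, of _ d]
    by (intro divide_right_mono order_trans[OF sum_abs] sum_mono) (auto simp: h_def)
  also have "\<dots> = ?e"
    unfolding sum_constant using pos by (intro nonzero_mult_div_cancel_left) linarith
  finally show ?thesis .
qed

section \<open>Limit of the acceptance rate\<close>

text \<open>With \<open>q d\<close> the exit probability of one coordinate, \<open>k d * q d\<close>
  equals \<open>cs d * (d * q d)\<close> and tends to \<open>c * l * f_star g / 2\<close>, so
  \<open>(1 - q d) ^ k d\<close> has the exponential limit. The remaining error vanishes by the
  second moment bound.\<close>

lemma avg_acceptance_rate_tendsto:
  assumes cs: "\<And>d. d \<ge> 1 \<Longrightarrow> 0 < cs d \<and> cs d \<le> 1 \<and> cs d * real d \<in> \<int>"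
    and lim: "cs \<longlonglongrightarrow> c" and l: "0 < l"
  shows "(\<lambda>d. avg_acceptance_rate g d (cs d) l) \<longlonglongrightarrow> limit_acceptance_rate g c l"
proof -
  \<comment> \<open>For \<open>d \<ge> 1\<close> the product is a nonnegative integer, so rounding
    down changes nothing; the value at \<open>d = 0\<close> does not affect the limit.\<close>
  define k where "k d = nat \<lfloor>cs d * real d\<rfloor>" for d
  define q where "q d = 1 - (\<integral>p. inside (l / real d) p \<partial>(target1 \<Otimes>\<^sub>M increment1))" for d
  define m where "m d = (\<integral>p. log_ratio (l / real d) p \<partial>(target1 \<Otimes>\<^sub>M increment1))" for d
  have k: "cs d * real d = real (k d)" "k d \<le> d" if d: "d \<ge> 1" for d
  proof -
    obtain n :: int where n: "cs d * real d = of_int n" using cs[OF d] by (auto elim: Ints_cases)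
    have "0 \<le> cs d * real d" using cs[OF d] by simp
    then show eq: "cs d * real d = real (k d)" unfolding k_def n by simp
    have "cs d * real d \<le> 1 * real d" using cs[OF d] by (intro mult_right_mono) auto
    then show "k d \<le> d" by (simp add: eq)
  qed
  have q_lim: "(\<lambda>d. real d * q d) \<longlonglongrightarrow> l * f_star g / 2"
    unfolding q_def by (rule exit_probability[OF l])
  have m_lim: "(\<lambda>d. real d * m d) \<longlonglongrightarrow> 0"
    unfolding m_def by (rule mean_log_ratio[OF l])
  have main: "(\<lambda>d. (1 - q d) ^ k d) \<longlonglongrightarrow> exp (- (c * (l * f_star g / 2)))"
  proof (rule one_minus_power_tendsto_exp)
    show "0 \<le> q d" for d
    proof -
      have "integrable (target1 \<Otimes>\<^sub>M increment1) (inside (l / real d))"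
        by (intro TV.integrable_const_bound[where B = 1]) (auto simp: inside_def indicator_def)
      then show ?thesis
        unfolding q_def diff_ge_0_iff_ge
        by (rule TV.integral_le_const) (intro AE_I2, auto simp: inside_def indicator_def)
    qed
    have "(\<lambda>d. (real d * q d) * (1 / real d)) \<longlonglongrightarrow> (l * f_star g / 2) * 0"
      by (intro tendsto_mult q_lim lim_const_over_n)
    then show "q \<longlonglongrightarrow> 0"
      by (rule_tac Lim_transform_eventually)
        (auto intro!: eventually_mono[OF eventually_gt_at_top[of 0]])
    have "(\<lambda>d. cs d * (real d * q d)) \<longlonglongrightarrow> c * (l * f_star g / 2)"
      by (intro tendsto_mult q_lim lim)
    then show "(\<lambda>d. real (k d) * q d) \<longlonglongrightarrow> c * (l * f_star g / 2)"
      by (rule Lim_transform_eventually)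
        (use eventually_ge_at_top[of 1] in eventually_elim, simp add: k(1)[symmetric])
  qed
  have error: "(\<lambda>d. avg_acceptance_rate g d (cs d) l - (1 - q d) ^ k d) \<longlonglongrightarrow> 0"
  proof (rule Lim_null_comparison)
    show "\<forall>\<^sub>F d in sequentially. norm (avg_acceptance_rate g d (cs d) l - (1 - q d) ^ k d)
        \<le> sqrt ((M * l)\<^sup>2 * (1 / real d) + (real d * m d)\<^sup>2)"
      using eventually_ge_at_top[of 1]
    proof eventually_elim
      case (elim d)
      have "norm (avg_acceptance_rate g d (cs d) l - (1 - q d) ^ k d)
          \<le> sqrt (k d * (M * (l / real d))\<^sup>2 + (k d * m d)\<^sup>2)"
        using avg_acceptance_rate_approx[OF k[OF elim] l] by (simp add: q_def m_def)
      \<comment> \<open>Enlarging \<open>k d\<close> to \<open>d\<close> brings in the rescaled mean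
        \<open>d * m d\<close>, whose limit is 0.\<close>
      also have "\<dots> \<le> sqrt (d * (M * (l / real d))\<^sup>2 + (d * m d)\<^sup>2)"
        unfolding power_mult_distrib[of _ "m d"] using k(2)[OF elim]
        by (intro real_sqrt_le_mono add_mono mult_right_mono power_mono) auto
      also have "d * (M * (l / real d))\<^sup>2 = (M * l)\<^sup>2 * (1 / real d)"
        using elim by (simp add: power2_eq_square field_simps)
      finally show ?case .
    qed
    have "(\<lambda>d. sqrt ((M * l)\<^sup>2 * (1 / real d) + (real d * m d)\<^sup>2)) \<longlonglongrightarrow> sqrt ((M * l)\<^sup>2 * 0 + 0\<^sup>2)"
      by (intro tendsto_intros m_lim lim_const_over_n)
    then show "(\<lambda>d. sqrt ((M * l)\<^sup>2 * (1 / real d) + (real d * m d)\<^sup>2)) \<longlonglongrightarrow> 0" by simp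
  qed
  show ?thesis
    using tendsto_add[OF error main] by (simp add: limit_acceptance_rate_def mult_ac)
qed

section \<open>Optimal scaling\<close>

text \<open>In the variable \<open>t = a * l / 4\<close>, with \<open>a = c * f_star g\<close>, the
  diffusion speed is its value at \<open>t = 1\<close> times
  \<open>(t * exp (1 - t))\<^sup>2\<close>, and this factor is at most 1. The point
  \<open>t = 1\<close> is the optimal scaling.\<close>

lemma diffusion_speed_le:
  assumes "0 < c" and "0 < l"
  shows "diffusion_speed g c l \<le> diffusion_speed g c (optimal_scaling g c)"
proof -
  define a where "a = c * f_star g"
  define t where "t = a * l / 4"
  have a: "0 < a" using assms f_star_pos by (simp add: a_def)
  have t: "0 < t" using a assms by (simp add: t_def)
  have l: "l = 4 * t / a" using a by (simp add: t_def)
  have "(t * exp (1 - t))\<^sup>2 \<le> 1\<^sup>2"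
    using t mult_exp_one_minus_le_one[of t] by (intro power_mono) auto
  then have le: "t\<^sup>2 * exp (2 - 2 * t) \<le> 1"
    by (simp add: power_mult_distrib exp_double[symmetric] algebra_simps)
  have "diffusion_speed g c l = c * (4 * t / a)\<^sup>2 / 3 * exp (- 2 * t)"
    unfolding diffusion_speed_def using a by (simp add: l a_def)
  also have "\<dots> = c * (4 / a)\<^sup>2 / 3 * exp (- 2) * (t\<^sup>2 * exp (2 - 2 * t))"
    by (simp add: power_mult_distrib power_divide exp_diff exp_minus field_simps)
  also have "\<dots> \<le> c * (4 / a)\<^sup>2 / 3 * exp (- 2) * 1"
    using assms by (intro mult_left_mono le) auto
  also have "\<dots> = diffusion_speed g c (optimal_scaling g c)"
    using a assms f_star_pos by (simp add: diffusion_speed_def optimal_scaling_def a_def)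
  finally show ?thesis .
qed

lemma optimal_scaling_pos: "0 < c \<Longrightarrow> 0 < optimal_scaling g c"
  using f_star_pos by (simp add: optimal_scaling_def)

end

theorem corollary3p4:
  fixes g g' :: "real \<Rightarrow> real" and c :: real
  assumes "\<And>x. x \<in> {0..1} \<Longrightarrow> (g has_real_derivative g' x) (at x within {0..1})"
    and "g' differentiable_on {0..1}"
    and "bdd_above ((\<lambda>y. \<bar>g' y\<bar>) ` {0..1})"
    and "0 < c" and "c \<le> 1"
  shows "(\<forall>cs :: nat \<Rightarrow> real.
            (\<forall>d\<ge>1. 0 < cs d \<and> cs d \<le> 1 \<and> cs d * real d \<in> \<int>) \<and> cs \<longlonglongrightarrow> c \<longrightarrow>
            (\<forall>l>0. (\<lambda>d. avg_acceptance_rate g d (cs d) l) \<longlonglongrightarrow> limit_acceptance_rate g c l))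
       \<and> is_arg_max (diffusion_speed g c) (\<lambda>l. l > 0) (optimal_scaling g c)
       \<and> diffusion_speed g c (optimal_scaling g c)
           = 1 / c * diffusion_speed g 1 (optimal_scaling g 1)
       \<and> limit_acceptance_rate g c (optimal_scaling g c) = exp (- 2)
       \<and> \<bar>exp (- 2) - (0.1353 :: real)\<bar> < 0.00005"
proof -
  obtain M where M: "\<And>x. x \<in> {0..1} \<Longrightarrow> \<bar>g' x\<bar> \<le> M"
    using assms(3) unfolding bdd_above_def by blast
  \<comment> \<open>Differentiability of \<open>g'\<close> supplies its continuity, and its
    boundedness the Lipschitz constant \<open>M\<close>.\<close>
  interpret lipschitz_log_density g g' M
    using assms(1,2) M by unfold_locales (auto intro: differentiable_imp_continuous_on)
  show ?thesis
  proof (intro conjI allI impI)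
    fix cs :: "nat \<Rightarrow> real" and l :: real
    assume "(\<forall>d\<ge>1. 0 < cs d \<and> cs d \<le> 1 \<and> cs d * real d \<in> \<int>) \<and> cs \<longlonglongrightarrow> c" and "0 < l"
    then show "(\<lambda>d. avg_acceptance_rate g d (cs d) l) \<longlonglongrightarrow> limit_acceptance_rate g c l"
      by (intro avg_acceptance_rate_tendsto) auto
  next
    show "is_arg_max (diffusion_speed g c) (\<lambda>l. l > 0) (optimal_scaling g c)"
      using diffusion_speed_le optimal_scaling_pos assms(4)
      by (auto simp: is_arg_max_linorder)
    show "diffusion_speed g c (optimal_scaling g c) = 1 / c * diffusion_speed g 1 (optimal_scaling g 1)"
      using assms(4) f_star_pos
      by (simp add: diffusion_speed_def optimal_scaling_def power2_eq_square)
    show "limit_acceptance_rate g c (optimal_scaling g c) = exp (- 2)"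
      using assms(4) f_star_pos by (simp add: limit_acceptance_rate_def optimal_scaling_def)
  qed (rule exp_minus_2_approx)
qed

end
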